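(* Fix integers $k,r,d\geq 2$, a graph $H$ on $r$ vertices, and a subset $S\subseteq \mathbb{S}^{d-1} \subseteq \mathbb{R}^d$ of size $k$. Then there is a constant $C=C_{S,r}$, depending only on $S$ and $r$, such that the following holds. For every positive integer $n$, positive real number $\alpha > 0$, and colouring $c\colon E(K_{nr}) \to S$ such that $\left\|\sum_{e\in E(K_{nr})} c(e)\right\| \leq \alpha$, there is an $H$-factor $F$ of $K_{nr}$ such that $$\left\|\sum_{e\in E(F)} c(e)\right\| \leq C + \frac{2\alpha}{n}.$$ Moreover, if $S$ is the vertex set of a regular simplex with $d+1$ vertices inscribed in $\mathbb{S}^{d-1}$ (so $k=d+1$), then one may take $C = (8dr)^{(8dr)^{d+1}}$.
   Context: $\|\cdot\|$ is the Euclidean norm on $\mathbb{R}^d$ and $\mathbb{S}^{d-1}$ is the unit sphere in $\mathbb{R}^d$. $K_N$ denotes the complete graph on $N$ vertices. For a graph $H$ on $r$ vertices, an $H$-factor of $K_{nr}$ is a subgraph consisting of $n$ vertex-disjoint copies of $H$, together covering all $nr$ vertices. Colourings are arbitrary functions on edges. *)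

theory Defs
  imports
    "HOL-Analysis.Analysis"
    "HOL-Library.Ramsey"
    "HOL-Library.Disjoint_Sets"
begin

text \<open>Edges are two-element sets of vertices.\<close>

type_synonym 'a graph = "'a set \<times> 'a set set"

abbreviation verts :: "'a graph \<Rightarrow> 'a set" where
  "verts G \<equiv> fst G"

abbreviation edges :: "'a graph \<Rightarrow> 'a set set" where
  "edges G \<equiv> snd G"

definition simple_graph :: "'a graph \<Rightarrow> bool" where
  "simple_graph G \<longleftrightarrow> finite (verts G) \<and> edges G \<subseteq> nsets (verts G) 2"

definition complete_graph :: "nat \<Rightarrow> nat graph" where
  "complete_graph N = ({..<N}, nsets {..<N} 2)"

definition subgraph :: "'a graph \<Rightarrow> 'a graph \<Rightarrow> bool" where
  "subgraph F G \<longleftrightarrow> simple_graph F \<and> verts F \<subseteq> verts G \<and> edges F \<subseteq> edges G"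

definition graph_iso :: "'a graph \<Rightarrow> 'b graph \<Rightarrow> bool" where
  "graph_iso H G \<longleftrightarrow>
     (\<exists>f. bij_betw f (verts H) (verts G) \<and> edges G = (\<lambda>e. f ` e) ` edges H)"

text \<open>The copies of \<open>H\<close> need not be induced: \<open>F\<close> is their union, and \<open>G\<close> may have
  further edges.\<close>

definition is_factor :: "'b graph \<Rightarrow> nat \<Rightarrow> 'a graph \<Rightarrow> 'a graph \<Rightarrow> bool" where
  "is_factor H n G F \<longleftrightarrow>
     subgraph F G \<and> verts F = verts G \<and>
     (\<exists>D :: nat \<Rightarrow> 'a graph.
        (\<forall>i<n. graph_iso H (D i)) \<and>
        disjoint_family_on (\<lambda>i. verts (D i)) {..<n} \<and>
        verts F = (\<Union>i<n. verts (D i)) \<and>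
        edges F = (\<Union>i<n. edges (D i)))"

definition regular_simplex_vertices :: "'a::euclidean_space set \<Rightarrow> bool" where
  "regular_simplex_vertices S \<longleftrightarrow>
     finite S \<and> \<not> affine_dependent S \<and>
     (\<exists>l. \<forall>x\<in>S. \<forall>y\<in>S. x \<noteq> y \<longrightarrow> dist x y = l)"

end

theory Submission
  imports Defs
begin

text \<open>
  It suffices to control how often each colour occurs in the factor, so the geometry of \<open>S\<close> plays
  no role and the constant depends only on \<open>k\<close> and \<open>r\<close>. Mix \<open>r\<close> copies of \<open>H\<close> in the
  factor into \<open>r\<close> new ones, by choosing an arbitrary vertex for each role and rotating within the
  copies. Averaged over all choices, this moves the colour-count vector exactly towards a multiple
  \<open>target\<close> of the colour counts of the whole complete graph. The change of such a move takes
  boundedly many values, and moves whose value is not available in many disjoint places contribute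
  only \<open>O(1)\<close>. Hence, up to \<open>O(1)\<close>, the vector from the current count to the target lies in the
  cone of the frequent values. Representing it with boundedly many uses of linearly independent
  integer vectors, scaling to a fixed length and rounding gives disjoint moves that bring the counts
  strictly closer to the target whenever they are farther from it than a constant.
\<close>

section \<open>Linear algebra: bounded coefficients in cones of integer vectors\<close>

text \<open>
  Fraction-free elimination of one coordinate squares the bound \<open>B\<close>, whence the exponent. This
  avoids Cramer's rule.
\<close>

lemma independent_int_coeff_bound:
  fixes v :: "'i \<Rightarrow> 's \<Rightarrow> int" and lam :: "'i \<Rightarrow> real"
  assumes "finite J" "finite I"
    and "\<And>a :: 'i \<Rightarrow> real. (\<forall>s\<in>J. (\<Sum>i\<in>I. a i * v i s) = 0) \<Longrightarrow> (\<forall>i\<in>I. a i = 0)"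
    and "\<And>i s. i \<in> I \<Longrightarrow> s \<in> J \<Longrightarrow> 2 * \<bar>real_of_int (v i s)\<bar> \<le> B"
    and "1 \<le> B"
    and "\<And>s. s \<in> J \<Longrightarrow> \<bar>\<Sum>i\<in>I. lam i * v i s\<bar> \<le> W"
    and "i0 \<in> I"
  shows "\<bar>lam i0\<bar> \<le> B ^ (2 ^ card J - 1) * W"
  using assms
proof (induction "card J" arbitrary: J I v B W)
  case 0
  then have "\<forall>i\<in>I. (\<lambda>_. 1 :: real) i = 0"
    by (intro "0.prems"(3)) auto
  with 0 show ?case by auto
next
  case (Suc q)
  note indep = Suc.prems(3) and bd = Suc.prems(4) and sumW = Suc.prems(6)
  \<comment> \<open>A zero vector would make the indicator of its index a nontrivial
    relation.\<close>
  have nz: "\<exists>s\<in>J. v i s \<noteq> 0" if "i \<in> I" for i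
  proof (rule ccontr)
    assume "\<not> ?thesis"
    then have "\<forall>s\<in>J. (\<Sum>k\<in>I. of_bool (k = i) * real_of_int (v k s)) = 0"
      by (auto intro!: sum.neutral)
    from indep[OF this] that show False by auto
  qed
  have W0: "0 \<le> W"
    using sumW nz[OF Suc.prems(7)] by fastforce
  show ?case
  proof (cases "I = {i0}")
    case True
    obtain s where s: "s \<in> J" "v i0 s \<noteq> 0"
      using nz Suc.prems(7) by blast
    then have "1 \<le> \<bar>real_of_int (v i0 s)\<bar>" by linarith
    then have "\<bar>lam i0\<bar> * 1 \<le> \<bar>lam i0\<bar> * \<bar>real_of_int (v i0 s)\<bar>"
      by (intro mult_left_mono) auto
    also have "\<dots> \<le> W"
      using sumW[OF s(1)] True by (simp add: abs_mult)
    also have "\<dots> \<le> B ^ (2 ^ card J - 1) * W"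
      using W0 one_le_power[OF Suc.prems(5)] by (simp add: mult_le_cancel_right1)
    finally show ?thesis by simp
  next
    case False
    then obtain i1 where i1: "i1 \<in> I" "i1 \<noteq> i0"
      using Suc.prems(7) by blast
    obtain j where j: "j \<in> J" "v i1 j \<noteq> 0"
      using nz i1 by blast
    \<comment> \<open>Pivot on the entry \<open>v i1 j\<close>: cross-multiplication clears
      coordinate \<open>j\<close> from the other vectors and stays in the integers, so
      \<open>i1\<close> and \<open>j\<close> both leave the induction.\<close>
    define u where "u i s = v i1 j * v i s - v i j * v i1 s" for i s
    let ?I = "I - {i1}" and ?J = "J - {j}"
    have card: "q = card ?J"
      using Suc.hyps(2) j Suc.prems(1) by simp
    have split: "(\<Sum>i\<in>?I. a i * real_of_int (u i s)) =
        v i1 j * (\<Sum>i\<in>I. a i * v i s) - (\<Sum>i\<in>I. a i * v i j) * v i1 s" for a :: "'i \<Rightarrow> real" and s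
    proof -
      have "(\<Sum>i\<in>?I. a i * real_of_int (u i s)) = (\<Sum>i\<in>I. a i * real_of_int (u i s))"
        using i1 Suc.prems(2) by (simp add: sum.remove u_def)
      also have "\<dots> = v i1 j * (\<Sum>i\<in>I. a i * v i s) - (\<Sum>i\<in>I. a i * v i j) * v i1 s"
        by (simp add: u_def sum_subtractf sum_distrib_left sum_distrib_right algebra_simps)
      finally show ?thesis .
    qed
    have ind: "\<forall>i\<in>?I. a i = 0" if a: "\<forall>s\<in>?J. (\<Sum>i\<in>?I. a i * real_of_int (u i s)) = 0" for a :: "'i \<Rightarrow> real"
    proof -
      have zero: "(\<Sum>i\<in>?I. a i * real_of_int (u i s)) = 0" if "s \<in> J" for s
        using a that by (cases "s = j") (auto simp: u_def mult.commute)
      \<comment> \<open>A relation among the \<open>u i\<close> lifts to the \<open>v i\<close>: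
        scale by the pivot and give \<open>i1\<close> the coefficient that cancels coordinate
        \<open>j\<close>.\<close>
      define a' where "a' i = (if i = i1 then - (\<Sum>i\<in>?I. a i * v i j) else v i1 j * a i)" for i
      have "(\<Sum>i\<in>I. a' i * v i s) = (\<Sum>i\<in>?I. a i * real_of_int (u i s))" for s
      proof -
        have "(\<Sum>i\<in>I. a' i * v i s) = a' i1 * v i1 s + (\<Sum>i\<in>?I. a' i * v i s)"
          using i1 Suc.prems(2) by (simp add: sum.remove)
        also have "(\<Sum>i\<in>?I. a' i * v i s) = (\<Sum>i\<in>?I. v i1 j * a i * v i s)"
          by (intro sum.cong) (auto simp: a'_def)
        finally show ?thesis
          by (simp add: a'_def u_def sum_subtractf sum_distrib_left sum_distrib_right algebra_simps)
      qed
      with zero have "\<forall>i\<in>I. a' i = 0" by (intro indep) auto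
      with j show ?thesis by (auto simp: a'_def split: if_splits)
    qed
    have hb: "\<bar>real_of_int (v i s)\<bar> \<le> B / 2" if "i \<in> I" "s \<in> J" for i s
      using bd[OF that] by simp
    \<comment> \<open>Entries of size at most \<open>B / 2\<close> make each of the two products in
      \<open>u\<close> at most \<open>B^2 / 4\<close>, so the hypothesis with its factor 2 returns
      with \<open>B^2\<close>, while \<open>W\<close> becomes \<open>B * W\<close>. The exponent
      thus obeys e(q+1) = 2 e(q) + 1.\<close>
    have "\<bar>lam i0\<bar> \<le> (B\<^sup>2) ^ (2 ^ card ?J - 1) * (B * W)"
    proof (rule Suc.hyps(1)[OF card, where I = ?I and v = u])
      fix i s assume ij: "i \<in> ?I" "s \<in> ?J"
      have "\<bar>real_of_int (u i s)\<bar> \<le>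
          \<bar>real_of_int (v i1 j)\<bar> * \<bar>real_of_int (v i s)\<bar> + \<bar>real_of_int (v i j)\<bar> * \<bar>real_of_int (v i1 s)\<bar>"
        unfolding u_def of_int_diff of_int_mult abs_mult[symmetric] by (rule abs_triangle_ineq4)
      also have "\<dots> \<le> (B / 2) * (B / 2) + (B / 2) * (B / 2)"
        using ij i1 j Suc.prems(5) by (intro add_mono mult_mono hb) auto
      finally show "2 * \<bar>real_of_int (u i s)\<bar> \<le> B\<^sup>2"
        by (simp add: power2_eq_square)
    next
      fix s assume s: "s \<in> ?J"
      have "\<bar>\<Sum>i\<in>?I. lam i * real_of_int (u i s)\<bar> \<le>
          \<bar>real_of_int (v i1 j)\<bar> * \<bar>\<Sum>i\<in>I. lam i * v i s\<bar> + \<bar>\<Sum>i\<in>I. lam i * v i j\<bar> * \<bar>real_of_int (v i1 s)\<bar>"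
        unfolding split abs_mult[symmetric] by (rule abs_triangle_ineq4)
      also have "\<dots> \<le> (B / 2) * W + W * (B / 2)"
        using s i1 j Suc.prems(5) W0 by (intro add_mono mult_mono hb sumW) auto
      finally show "\<bar>\<Sum>i\<in>?I. lam i * real_of_int (u i s)\<bar> \<le> B * W"
        by (simp add: algebra_simps)
    qed (use Suc.prems i1 ind in auto)
    also have "\<dots> = B ^ (2 * (2 ^ q - 1) + 1) * W"
      by (simp add: card power_mult mult.assoc)
    also have "2 * (2 ^ q - 1) + 1 = 2 ^ card J - (1 :: nat)"
    proof -
      have "(1 :: nat) \<le> 2 ^ q" by simp
      then show ?thesis unfolding Suc.hyps(2)[symmetric] power_Suc by linarith
    qed
    finally show ?thesis .
  qed
qed

text \<open>Caratheodory's reduction: while a relation among the vectors remains, subtract its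
  largest multiple that keeps all coefficients nonnegative. Some coefficient becomes zero and its
  index is dropped.\<close>

lemma independent_cone_representation:
  fixes v :: "'i \<Rightarrow> 's \<Rightarrow> int" and lam :: "'i \<Rightarrow> real"
  assumes "finite I" and "\<forall>i\<in>I. 0 \<le> lam i"
  shows "\<exists>I' \<subseteq> I. \<exists>mu :: 'i \<Rightarrow> real. (\<forall>i\<in>I'. 0 \<le> mu i) \<and>
    (\<forall>s\<in>J. (\<Sum>i\<in>I'. mu i * v i s) = (\<Sum>i\<in>I. lam i * v i s)) \<and>
    (\<forall>a :: 'i \<Rightarrow> real. (\<forall>s\<in>J. (\<Sum>i\<in>I'. a i * v i s) = 0) \<longrightarrow> (\<forall>i\<in>I'. a i = 0))"
  using assms
proof (induction I arbitrary: lam rule: finite_psubset_induct)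
  case (psubset I)
  show ?case
  proof (cases "\<forall>a :: 'i \<Rightarrow> real. (\<forall>s\<in>J. (\<Sum>i\<in>I. a i * v i s) = 0) \<longrightarrow> (\<forall>i\<in>I. a i = 0)")
    case True
    then show ?thesis using psubset.prems by (intro exI[of _ I] conjI exI[of _ lam]) auto
  next
    case False
    then obtain a0 :: "'i \<Rightarrow> real" and i0
      where a0: "\<forall>s\<in>J. (\<Sum>i\<in>I. a0 i * v i s) = 0" "i0 \<in> I" "a0 i0 \<noteq> 0" by blast
    \<comment> \<open>After a possible change of sign some coefficient is positive, so the multiple
      that may be subtracted is bounded.\<close>
    define a where "a i = (if a0 i0 > 0 then a0 i else - a0 i)" for i
    have a: "\<forall>s\<in>J. (\<Sum>i\<in>I. a i * v i s) = 0" "a i0 > 0"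
      using a0 by (cases "a0 i0 > 0"; auto simp: a_def sum_negf)+
    define R where "R = {i\<in>I. a i > 0}"
    have R: "finite R" "R \<noteq> {}"
      using a a0 psubset.hyps by (auto simp: R_def)
    \<comment> \<open>The index with the smallest ratio is the first whose coefficient reaches
      zero.\<close>
    obtain i1 where i1: "i1 \<in> R" "\<And>i. i \<in> R \<Longrightarrow> lam i1 / a i1 \<le> lam i / a i"
      using arg_min_if_finite(1)[OF R, of "\<lambda>i. lam i / a i"]
        arg_min_least[OF R, of _ "\<lambda>i. lam i / a i"] by blast
    define t where "t = lam i1 / a i1"
    define mu where "mu i = lam i - t * a i" for i
    have I1: "i1 \<in> I" "a i1 > 0" using i1 by (auto simp: R_def)
    have t0: "t \<ge> 0" using I1 psubset.prems by (auto simp: t_def)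
    have mu0: "mu i \<ge> 0" if "i \<in> I" for i
    proof (cases "a i > 0")
      case True
      then have "t \<le> lam i / a i" using that i1 by (auto simp: R_def t_def)
      then show ?thesis using True by (simp add: mu_def field_simps)
    next
      case False
      then have "t * a i \<le> 0" using t0 by (simp add: mult_nonneg_nonpos)
      then show ?thesis using bspec[OF psubset.prems that] by (simp add: mu_def)
    qed
    have mu1: "mu i1 = 0" using I1 by (simp add: mu_def t_def)
    have mus: "(\<Sum>i\<in>I-{i1}. mu i * v i s) = (\<Sum>i\<in>I. lam i * v i s)" if "s \<in> J" for s
    proof -
      have "(\<Sum>i\<in>I-{i1}. mu i * v i s) = (\<Sum>i\<in>I. mu i * v i s)"
        using I1 psubset.hyps mu1 by (simp add: sum.remove)
      also have "\<dots> = (\<Sum>i\<in>I. lam i * v i s) - t * (\<Sum>i\<in>I. a i * v i s)"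
        by (simp add: mu_def sum_subtractf sum_distrib_left algebra_simps)
      finally show ?thesis using a that by simp
    qed
    have "I - {i1} \<subset> I" using I1 by auto
    from psubset.IH[OF this, of mu] mu0
    obtain I' and mu' :: "'i \<Rightarrow> real" where "I' \<subseteq> I - {i1}" and mu': "\<forall>i\<in>I'. 0 \<le> mu' i"
      "\<forall>s\<in>J. (\<Sum>i\<in>I'. mu' i * v i s) = (\<Sum>i\<in>I - {i1}. mu i * v i s)"
      "\<forall>a :: 'i \<Rightarrow> real. (\<forall>s\<in>J. (\<Sum>i\<in>I'. a i * v i s) = 0) \<longrightarrow> (\<forall>i\<in>I'. a i = 0)"
      by blast
    then have "I' \<subseteq> I" by blast
    moreover have "\<forall>s\<in>J. (\<Sum>i\<in>I'. mu' i * v i s) = (\<Sum>i\<in>I. lam i * v i s)"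
      using mu'(2) mus by simp
    ultimately show ?thesis
      using mu'(1,3) by (intro exI[of _ I'] conjI exI[of _ mu'])
  qed
qed

text \<open>Over an independent subfamily the elimination bound applies, and it depends neither on
  \<open>lam\<close> nor on the size of \<open>I\<close>. Indices outside the subfamily get
  coefficient 0.\<close>

lemma bounded_cone_representation:
  fixes v :: "'i \<Rightarrow> 's \<Rightarrow> int" and lam :: "'i \<Rightarrow> real"
  assumes "finite J" "finite I" "\<And>i. i \<in> I \<Longrightarrow> 0 \<le> lam i"
    and "\<And>i s. i \<in> I \<Longrightarrow> s \<in> J \<Longrightarrow> 2 * \<bar>real_of_int (v i s)\<bar> \<le> B"
    and "1 \<le> B"
    and "\<And>s. s \<in> J \<Longrightarrow> \<bar>\<Sum>i\<in>I. lam i * v i s\<bar> \<le> W" and "0 \<le> W"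
  obtains mu :: "'i \<Rightarrow> real" where "\<And>i. i \<in> I \<Longrightarrow> 0 \<le> mu i"
    and "\<And>i. i \<in> I \<Longrightarrow> mu i \<le> B ^ (2 ^ card J - 1) * W"
    and "\<And>s. s \<in> J \<Longrightarrow> (\<Sum>i\<in>I. mu i * v i s) = (\<Sum>i\<in>I. lam i * v i s)"
proof -
  obtain I' and mu :: "'i \<Rightarrow> real" where I': "I' \<subseteq> I" and mu: "\<forall>i\<in>I'. 0 \<le> mu i"
    and mus: "\<forall>s\<in>J. (\<Sum>i\<in>I'. mu i * v i s) = (\<Sum>i\<in>I. lam i * v i s)"
    and ind: "\<forall>a :: 'i \<Rightarrow> real. (\<forall>s\<in>J. (\<Sum>i\<in>I'. a i * v i s) = 0) \<longrightarrow> (\<forall>i\<in>I'. a i = 0)"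
    using independent_cone_representation[of I lam J v] assms(2,3) by blast
  have "\<bar>mu i\<bar> \<le> B ^ (2 ^ card J - 1) * W" if "i \<in> I'" for i
    using assms I' ind mus that finite_subset[OF I']
    by (intro independent_int_coeff_bound[of J I' v]) auto
  moreover have "(\<Sum>i\<in>I. (if i \<in> I' then mu i else 0) * v i s) = (\<Sum>i\<in>I'. mu i * v i s)" for s
    using I' assms(2) by (intro sum.mono_neutral_cong_right) auto
  moreover have "0 \<le> B ^ (2 ^ card J - 1) * W" using assms by simp
  ultimately show ?thesis
    using mu mus by (intro that[of "\<lambda>i. if i \<in> I' then mu i else 0"]) (auto dest: abs_le_D1)
qed

section \<open>Sums over function spaces and ordered pairs; residues\<close>

text \<open>An extensional function on \<open>insert a I\<close> is a value at \<open>a\<close>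
  together with an extensional function on \<open>I\<close>; resetting \<open>a\<close> to
  \<open>undefined\<close> recovers the latter.\<close>

lemma sum_PiE_insert:
  fixes F :: "'a \<Rightarrow> ('i \<Rightarrow> 'a) \<Rightarrow> 'b :: comm_monoid_add"
  assumes "finite A" "finite I" "a \<notin> I"
  shows "(\<Sum>g\<in>insert a I \<rightarrow>\<^sub>E A. F (g a) (g(a := undefined))) = (\<Sum>x\<in>A. \<Sum>g\<in>I \<rightarrow>\<^sub>E A. F x g)"
proof -
  have "(\<Sum>g\<in>insert a I \<rightarrow>\<^sub>E A. F (g a) (g(a := undefined))) =
      (\<Sum>p\<in>A \<times> (I \<rightarrow>\<^sub>E A). F (fst p) ((snd p)(a := undefined)))"
    unfolding PiE_insert_eq using inj_combinator[OF assms(3), of "\<lambda>_. A"]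
    by (subst sum.reindex) (simp_all add: case_prod_unfold)
  also have "\<dots> = (\<Sum>(x, g)\<in>A \<times> (I \<rightarrow>\<^sub>E A). F x g)"
  proof (intro sum.cong refl)
    fix p assume "p \<in> A \<times> (I \<rightarrow>\<^sub>E A)"
    then have "snd p a = undefined" using assms(3) PiE_arb by fastforce
    then show "F (fst p) ((snd p)(a := undefined)) = (case p of (x, g) \<Rightarrow> F x g)"
      by (simp add: case_prod_unfold fun_upd_idem)
  qed
  finally show ?thesis by (simp add: sum.cartesian_product)
qed

lemma sum_PiE_single:
  fixes F :: "'a \<Rightarrow> 'b :: comm_semiring_1"
  assumes "finite A" "finite I" "a \<in> I"
  shows "(\<Sum>g\<in>I \<rightarrow>\<^sub>E A. F (g a)) = of_nat (card A) ^ (card I - 1) * (\<Sum>x\<in>A. F x)"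
proof -
  have I: "insert a (I - {a}) = I" using assms by auto
  show ?thesis
    using sum_PiE_insert[of A "I - {a}" a "\<lambda>x _. F x", unfolded I] assms
    by (simp add: card_PiE sum_distrib_left)
qed

text \<open>An edge of \<open>H\<close> involves two roles only, so its colour, summed over all
  moves, depends on two independent values; the other \<open>card I - 2\<close> values only
  contribute a power.\<close>

lemma sum_PiE_pair:
  fixes F :: "'a \<Rightarrow> 'a \<Rightarrow> 'b :: comm_semiring_1"
  assumes "finite A" "finite I" "a \<in> I" "b \<in> I" "a \<noteq> b"
  shows "(\<Sum>g\<in>I \<rightarrow>\<^sub>E A. F (g a) (g b)) =
    of_nat (card A) ^ (card I - 2) * (\<Sum>x\<in>A. \<Sum>y\<in>A. F x y)"
proof -
  have I: "insert a (I - {a}) = I" using assms by auto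
  have "(\<Sum>g\<in>I \<rightarrow>\<^sub>E A. F (g a) (g b)) = (\<Sum>x\<in>A. \<Sum>g\<in>(I - {a}) \<rightarrow>\<^sub>E A. F x (g b))"
    using sum_PiE_insert[of A "I - {a}" a "\<lambda>x g. F x (g b)", unfolded I] assms by simp
  also have "\<dots> = (\<Sum>x\<in>A. of_nat (card A) ^ (card (I - {a}) - 1) * (\<Sum>y\<in>A. F x y))"
    using assms by (intro sum.cong sum_PiE_single) auto
  finally show ?thesis
    using assms by (simp add: sum_distrib_left numeral_2_eq_2)
qed


text \<open>Each edge arises from two ordered pairs, and diagonal pairs give singletons, where
  \<open>f\<close> vanishes. Diagonal pairs occur because cells are chosen independently.\<close>

lemma sum_pairs_eq_nsets:
  fixes f :: "nat set \<Rightarrow> 'a :: comm_semiring_1"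
  assumes "\<And>v. f {v} = 0"
  shows "(\<Sum>u<N. \<Sum>v<N. f {u, v}) = 2 * (\<Sum>e\<in>nsets {..<N} 2. f e)"
proof (induction N)
  case 0
  have "nsets {..<0 :: nat} 2 = {}" by (auto simp: nsets_def)
  then show ?case by simp
next
  case (Suc N)
  have eq: "nsets {..<Suc N} 2 = nsets {..<N} 2 \<union> (\<lambda>u. {u, N}) ` {..<N}"
  proof (intro equalityI subsetI)
    fix e assume "e \<in> nsets {..<Suc N} 2"
    then obtain x y where "e = {x, y}" "x \<noteq> y" "x < Suc N" "y < Suc N"
      by (auto simp: nsets_def card_2_iff)
    then show "e \<in> nsets {..<N} 2 \<union> (\<lambda>u. {u, N}) ` {..<N}"
      by (auto simp: nsets_def less_Suc_eq)
  qed (auto simp: nsets_def)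
  have inj: "inj_on (\<lambda>u. {u, N}) {..<N}"
    by (auto simp: inj_on_def doubleton_eq_iff)
  have "(\<Sum>e\<in>nsets {..<Suc N} 2. f e) = (\<Sum>e\<in>nsets {..<N} 2. f e) + (\<Sum>u<N. f {u, N})"
    unfolding eq using inj
    by (subst sum.union_disjoint) (auto simp: sum.reindex finite_imp_finite_nsets nsets_def)
  moreover have "(\<Sum>u<Suc N. \<Sum>v<Suc N. f {u, v}) =
      (\<Sum>u<N. \<Sum>v<N. f {u, v}) + 2 * (\<Sum>u<N. f {u, N})"
    using assms[of N] by (simp add: sum.distrib insert_commute[of N] mult_2 algebra_simps)
  ultimately show ?case using Suc by (simp add: algebra_simps)
qed

text \<open>For cyclic shifts of roles this gives injectivity both in the role and in the amount of
  the shift.\<close>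

lemma add_mod_inj:
  fixes r :: nat
  assumes "t < r" "t' < r" "(z + t) mod r = (z + t') mod r"
  shows "t = t'"
proof -
  have *: "t \<le> t'" if "t < r" "t' < r" "(z + t) mod r = (z + t') mod r" for t t'
  proof (rule ccontr)
    assume "\<not> t \<le> t'"
    then have "r dvd (z + t) - (z + t')"
      using that by (subst mod_eq_dvd_iff_nat[symmetric]) auto
    then show False using that \<open>\<not> t \<le> t'\<close> by (auto dest: dvd_imp_le)
  qed
  show ?thesis using *[of t t'] *[of t' t] assms by simp
qed

section \<open>Copies, colour counts and mixing moves\<close>

text \<open>\<open>E\<close> is the edge set of \<open>H\<close> carried over to the roles
  \<open>{..<r}\<close>. A move may put both ends of an edge on one vertex; \<open>loop\<close>
  keeps such degenerate edges out of every count of a colour in \<open>S\<close>.\<close>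

locale factor_colouring =
  fixes n r :: nat and E :: "nat set set" and c :: "nat set \<Rightarrow> 'c" and S :: "'c set"
  assumes n_pos: "0 < n" and r_ge: "2 \<le> r" and E: "E \<subseteq> nsets {..<r} 2"
    and fin_S: "finite S" and loop: "c {v} \<notin> S"
begin

text \<open>The cell \<open>(i, a)\<close> is role \<open>a\<close> in the \<open>i\<close>-th copy.
  A factor is encoded as a bijection \<open>P\<close> from the cells to the vertices.\<close>

definition cells :: "(nat \<times> nat) set" where
  "cells = {..<n} \<times> {..<r}"

definition copy_count :: "(nat \<Rightarrow> nat) \<Rightarrow> 'c \<Rightarrow> int" where
  "copy_count q s = (\<Sum>e\<in>E. of_bool (c (q ` e) = s))"

definition count :: "(nat \<times> nat \<Rightarrow> nat) \<Rightarrow> 'c \<Rightarrow> int" where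
  "count P s = (\<Sum>i<n. copy_count (\<lambda>a. P (i, a)) s)"

definition total :: "'c \<Rightarrow> int" where
  "total s = (\<Sum>e\<in>nsets {..<n * r} 2. of_bool (c e = s))"

definition shift :: "nat \<Rightarrow> nat \<times> nat \<Rightarrow> nat \<times> nat" where
  "shift t x = (fst x, (snd x + t) mod r)"

text \<open>
  A move assigns to role \<open>a\<close> of \<open>H\<close> the cell \<open>g a\<close>; the \<open>t\<close>-th new copy uses the cells
  \<open>shift t (g a)\<close>. Only a move that is \<open>proper\<close>, meeting \<open>r\<close> different copies, yields a factor, but
  keeping the others makes the average exact.
\<close>

definition moves :: "(nat \<Rightarrow> nat \<times> nat) set" where
  "moves = {..<r} \<rightarrow>\<^sub>E cells"

abbreviation blocks :: "(nat \<Rightarrow> nat \<times> nat) \<Rightarrow> nat set" where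
  "blocks g \<equiv> (\<lambda>a. fst (g a)) ` {..<r}"

abbreviation proper :: "(nat \<Rightarrow> nat \<times> nat) \<Rightarrow> bool" where
  "proper g \<equiv> inj_on (\<lambda>a. fst (g a)) {..<r}"

text \<open>For a proper move this is the change of the colour counts. In general it is a formal
  difference in which an old copy is subtracted once for every role that chooses it, which makes the
  sum over all moves computable.\<close>

definition delta :: "(nat \<times> nat \<Rightarrow> nat) \<Rightarrow> (nat \<Rightarrow> nat \<times> nat) \<Rightarrow> 'c \<Rightarrow> int" where
  "delta P g s = (\<Sum>t<r. copy_count (\<lambda>a. P (shift t (g a))) s) -
     (\<Sum>a<r. copy_count (\<lambda>z. P (fst (g a), z)) s)"

lemma two_card_E: "2 * card E \<le> r * (r - 1)"
proof -
  have "card E \<le> card (nsets {..<r} 2)"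
    by (intro card_mono E finite_imp_finite_nsets) auto
  then show ?thesis by (simp add: card_nsets choose_two)
qed

text \<open>\<open>2 * r * card E + 1\<close> is the number of integers allowed for one coordinate
  of \<open>delta\<close>, and it exceeds the l1 norm of \<open>delta\<close>. Hence
  \<open>r ^ 3\<close> serves as both bounds.\<close>

lemma move_size_le: "2 * r * card E + 1 \<le> r ^ 3"
proof -
  have "2 * r * card E + 1 \<le> r * (r * (r - 1)) + 1"
    using mult_le_mono2[OF two_card_E, of r] by simp
  also have "\<dots> \<le> r * (r * (r - 1)) + r * r"
    using r_ge by (simp add: Suc_leI)
  also have "\<dots> = r ^ 3"
    using r_ge by (cases r) (simp_all add: power3_eq_cube algebra_simps)
  finally show ?thesis .
qed

lemma finite_cells: "finite cells"
  by (simp add: cells_def)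

lemma card_cells: "card cells = n * r"
  by (simp add: cells_def)

lemma sum_cells_fst: "(\<Sum>x\<in>cells. f (fst x)) = of_nat r * (\<Sum>i<n. f i :: 'b :: semiring_1)"
  using sum.cartesian_product[of "\<lambda>i _. f i" "{..<r}" "{..<n}"]
  by (simp add: cells_def case_prod_unfold sum_distrib_left)

lemma finite_moves: "finite moves"
  by (simp add: moves_def finite_PiE finite_cells)

lemma bij_shift: "bij_betw (shift t) cells cells"
proof -
  have "inj_on (shift t) cells"
    using add_mod_inj[where z = t] by (auto simp: inj_on_def cells_def shift_def add.commute)
  moreover have "shift t ` cells \<subseteq> cells"
    using r_ge by (auto simp: cells_def shift_def)
  ultimately show ?thesis
    by (simp add: bij_betw_def endo_inj_surj finite_cells)
qed

lemma copy_count_nonneg: "0 \<le> copy_count q s"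
  by (simp add: copy_count_def sum_nonneg)

lemma sum_copy_count_le: "(\<Sum>s\<in>S. copy_count q s) \<le> card E"
proof -
  have "(\<Sum>s\<in>S. copy_count q s) = (\<Sum>e\<in>E. \<Sum>s\<in>S. of_bool (c (q ` e) = s))"
    unfolding copy_count_def by (rule sum.swap)
  also have "\<dots> \<le> (\<Sum>e\<in>E. 1)"
    using fin_S by (intro sum_mono) (simp add: of_bool_def)
  finally show ?thesis by simp
qed

lemma copy_count_le: "copy_count q s \<le> card E"
proof -
  have "copy_count q s \<le> (\<Sum>e\<in>E. 1)"
    unfolding copy_count_def by (intro sum_mono) simp
  then show ?thesis by simp
qed

text \<open>Both sums in \<open>delta\<close> lie between 0 and \<open>r * card E\<close>, which
  saves the factor 2 of the triangle inequality.\<close>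

lemma abs_delta_le: "\<bar>delta P g s\<bar> \<le> r * card E"
proof -
  have "0 \<le> (\<Sum>t<r. copy_count (Q t) s) \<and> (\<Sum>t<r. copy_count (Q t) s) \<le> r * card E" for Q
    using sum_bounded_above[of "{..<r}" "\<lambda>t. copy_count (Q t) s" "int (card E)"]
    by (auto simp: copy_count_le copy_count_nonneg sum_nonneg)
  note this[of "\<lambda>t a. P (shift t (g a))"] this[of "\<lambda>a z. P (fst (g a), z)"]
  then show ?thesis unfolding delta_def by linarith
qed

lemma sum_abs_delta_le: "(\<Sum>s\<in>S. \<bar>delta P g s\<bar>) \<le> 2 * r * card E"
proof -
  have b: "(\<Sum>s\<in>S. \<Sum>t<r. copy_count (Q t) s) \<le> r * card E" for Q
    using sum_bounded_above[of "{..<r}" "\<lambda>t. \<Sum>s\<in>S. copy_count (Q t) s" "int (card E)"]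
    by (subst sum.swap) (auto simp: sum_copy_count_le)
  have "(\<Sum>s\<in>S. \<bar>delta P g s\<bar>) \<le> (\<Sum>s\<in>S. (\<Sum>t<r. copy_count (\<lambda>a. P (shift t (g a))) s) +
     (\<Sum>a<r. copy_count (\<lambda>z. P (fst (g a), z)) s))"
    unfolding delta_def
    by (intro sum_mono order_trans[OF abs_triangle_ineq4]) (simp add: copy_count_nonneg sum_nonneg)
  also have "\<dots> \<le> int (r * card E) + int (r * card E)"
    unfolding sum.distrib by (intro add_mono b)
  finally show ?thesis by simp
qed

section \<open>Exact averages over all moves\<close>

text \<open>For a fixed edge of \<open>H\<close>, its two cells run over all ordered pairs, each
  occurring \<open>(n * r) ^ (r - 2)\<close> times, so every edge of the complete graph is met twice
  as often. A general \<open>Q\<close> allows \<open>P\<close> to be composed with any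
  shift.\<close>

lemma sum_moves_copy_count:
  assumes "bij_betw Q cells {..<n * r}" "s \<in> S"
  shows "(\<Sum>g\<in>moves. copy_count (\<lambda>a. Q (g a)) s) = card E * (n * r) ^ (r - 2) * (2 * total s)"
proof -
  have edge: "(\<Sum>g\<in>moves. of_bool (c ((\<lambda>a. Q (g a)) ` e) = s)) = int ((n * r) ^ (r - 2)) * (2 * total s)"
    if "e \<in> E" for e
  proof -
    have "e \<subseteq> {..<r}" "card e = 2"
      using that E by (auto simp: nsets_def)
    then obtain a b where e: "e = {a, b}" "a \<noteq> b" "a < r" "b < r"
      by (auto simp: card_2_iff)
    have "(\<Sum>g\<in>moves. of_bool (c ((\<lambda>a. Q (g a)) ` e) = s)) =
        (\<Sum>g\<in>moves. (\<lambda>x y. of_bool (c {Q x, Q y} = s)) (g a) (g b))"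
      by (simp add: e)
    also have "\<dots> = int ((n * r) ^ (r - 2)) * (\<Sum>x\<in>cells. \<Sum>y\<in>cells. of_bool (c {Q x, Q y} = s))"
      unfolding moves_def using e by (subst sum_PiE_pair) (auto simp: finite_cells card_cells)
    also have "(\<Sum>x\<in>cells. \<Sum>y\<in>cells. of_bool (c {Q x, Q y} = s)) =
        (\<Sum>x\<in>cells. \<Sum>v<n*r. of_bool (c {Q x, v} = s) :: int)"
      by (intro sum.cong refl sum.reindex_bij_betw[OF assms(1)])
    also have "\<dots> = (\<Sum>u<n*r. \<Sum>v<n*r. of_bool (c {u, v} = s))"
      by (rule sum.reindex_bij_betw[OF assms(1)])
    also have "\<dots> = 2 * total s"
      unfolding total_def using loop assms(2) by (intro sum_pairs_eq_nsets) auto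
    finally show ?thesis .
  qed
  have "(\<Sum>g\<in>moves. copy_count (\<lambda>a. Q (g a)) s) =
      (\<Sum>e\<in>E. \<Sum>g\<in>moves. of_bool (c ((\<lambda>a. Q (g a)) ` e) = s))"
    unfolding copy_count_def by (rule sum.swap)
  also have "\<dots> = (\<Sum>e\<in>E. int ((n * r) ^ (r - 2)) * (2 * total s))"
    by (intro sum.cong refl edge)
  finally show ?thesis by (simp add: algebra_simps)
qed

text \<open>Each of the \<open>r\<close> new copies is made of independent cells, whereas each role
  chooses an old copy through any of its \<open>r\<close> cells. The result is a positive multiple
  of \<open>target s - count P s\<close>, with \<open>target\<close> as defined below.\<close>

lemma sum_delta:
  assumes "bij_betw P cells {..<n * r}" "s \<in> S"
  shows "(\<Sum>g\<in>moves. delta P g s) =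
    2 * r * card E * (n * r) ^ (r - 2) * total s - r\<^sup>2 * (n * r) ^ (r - 1) * count P s"
proof -
  have "(\<Sum>g\<in>moves. copy_count (\<lambda>a. P (shift t (g a))) s) = card E * (n * r) ^ (r - 2) * (2 * total s)" for t
    using sum_moves_copy_count[OF bij_betw_trans[OF bij_shift assms(1)] assms(2)]
    by (simp add: o_def)
  then have new: "(\<Sum>g\<in>moves. \<Sum>t<r. copy_count (\<lambda>a. P (shift t (g a))) s) =
      2 * r * card E * (n * r) ^ (r - 2) * total s"
    by (subst sum.swap) (simp add: algebra_simps)
  have "(\<Sum>g\<in>moves. copy_count (\<lambda>z. P (fst (g a), z)) s) = (n * r) ^ (r - 1) * (r * count P s)"
    if "a < r" for a
    unfolding moves_def using that
    by (subst sum_PiE_single[where F = "\<lambda>x. copy_count (\<lambda>z. P (fst x, z)) s"])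
       (auto simp: finite_cells card_cells count_def
         sum_cells_fst[of "\<lambda>i. copy_count (\<lambda>z. P (i, z)) s"])
  then have old: "(\<Sum>g\<in>moves. \<Sum>a<r. copy_count (\<lambda>z. P (fst (g a), z)) s) =
      r\<^sup>2 * (n * r) ^ (r - 1) * count P s"
    by (subst sum.swap) (simp add: power2_eq_square algebra_simps)
  show ?thesis
    unfolding delta_def sum_subtractf new old ..
qed

section \<open>Performing one move and many disjoint moves\<close>

lemma blocks_subset: "g \<in> moves \<Longrightarrow> blocks g \<subseteq> {..<n}"
  by (auto simp: moves_def cells_def PiE_def Pi_def mem_Times_iff)

text \<open>\<open>P'\<close> is \<open>P\<close> after a permutation of the cells. It is injective
  because the copy containing \<open>shift t (g a)\<close> determines \<open>a\<close> when the move
  is proper, and the rotation then determines \<open>t\<close>.\<close>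

lemma apply_move:
  assumes P: "bij_betw P cells {..<n * r}" and g: "g \<in> moves" "proper g"
  obtains P' where "bij_betw P' cells {..<n * r}"
    and "\<And>i z. i \<notin> blocks g \<Longrightarrow> P' (i, z) = P (i, z)"
    and "\<And>s. count P' s = count P s + delta P g s"
proof -
  \<comment> \<open>\<open>\<tau> t\<close> is the copy chosen by role \<open>t\<close>. The
    \<open>t\<close>-th new copy is stored there, and \<open>the_inv_into\<close> reads
    \<open>t\<close> back.\<close>
  define \<tau> where "\<tau> = (\<lambda>a. fst (g a))"
  define \<Phi> where "\<Phi> x = (if fst x \<in> blocks g
    then shift (the_inv_into {..<r} \<tau> (fst x)) (g (snd x)) else x)" for x
  have gc: "g a \<in> cells" if "a < r" for a
    using g that by (auto simp: moves_def)
  have inj: "inj_on \<tau> {..<r}" and bl: "blocks g = \<tau> ` {..<r}"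
    using g by (simp_all add: \<tau>_def)
  have \<Phi>1: "\<Phi> (\<tau> t, a) = shift t (g a)" if "t < r" for t a
    using that inj by (simp add: \<Phi>_def bl the_inv_into_f_f)
  have \<Phi>2: "\<Phi> (i, a) = (i, a)" if "i \<notin> blocks g" for i a
    using that by (simp only: \<Phi>_def fst_conv if_False)
  have fst\<Phi>: "fst (\<Phi> (i, a)) \<in> blocks g \<longleftrightarrow> i \<in> blocks g" if "a < r" for i a
    using that by (cases "i \<in> blocks g") (auto simp: \<Phi>_def shift_def)
  have "\<Phi> ` cells \<subseteq> cells"
  proof (rule image_subsetI)
    fix x assume x: "x \<in> cells"
    then have "g (snd x) \<in> cells" by (auto simp: cells_def intro: gc[unfolded cells_def])
    from bij_betw_apply[OF bij_shift this] x show "\<Phi> x \<in> cells"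
      by (simp only: \<Phi>_def split: if_split) blast
  qed
  moreover have "inj_on \<Phi> cells"
  proof (rule inj_onI)
    fix x y assume xy: "x \<in> cells" "y \<in> cells" "\<Phi> x = \<Phi> y"
    obtain i a where x: "x = (i, a)" by (cases x)
    obtain j b where y: "y = (j, b)" by (cases y)
    have ab: "a < r" "b < r" using xy by (auto simp: x y cells_def)
    show "x = y"
    proof (cases "i \<in> blocks g")
      case True
      then have "j \<in> blocks g" using fst\<Phi>[OF ab(1)] fst\<Phi>[OF ab(2)] xy(3) unfolding x y by metis
      with True obtain t t' where t: "t < r" "t' < r" "i = \<tau> t" "j = \<tau> t'"
        by (auto simp: bl)
      have eq: "shift t (g a) = shift t' (g b)"
        using xy t by (simp add: x y \<Phi>1)
      then have "\<tau> a = \<tau> b" by (simp add: shift_def \<tau>_def)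
      then have "a = b" using inj ab by (auto dest: inj_onD)
      moreover have "t = t'"
        using eq t \<open>a = b\<close> add_mod_inj[of t r t'] by (auto simp: shift_def)
      ultimately show ?thesis using t by (simp add: x y)
    next
      case False
      then have "j \<notin> blocks g" using fst\<Phi>[OF ab(1)] fst\<Phi>[OF ab(2)] xy(3) unfolding x y by metis
      with \<Phi>2[OF False, of a] \<Phi>2[of j b] xy(3) show ?thesis unfolding x y by metis
    qed
  qed
  ultimately have "bij_betw \<Phi> cells cells"
    by (simp add: bij_betw_def endo_inj_surj finite_cells)
  then have bij: "bij_betw (P \<circ> \<Phi>) cells {..<n * r}"
    using P by (rule bij_betw_trans)
  note sub = blocks_subset[OF g(1)]
  have cnt: "count (P \<circ> \<Phi>) s = count P s + delta P g s" for s
  proof -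
    let ?h = "\<lambda>P i. copy_count (\<lambda>a. P (i, a)) s"
    have split: "count Q s = (\<Sum>i\<in>{..<n} - blocks g. ?h Q i) + (\<Sum>t<r. ?h Q (\<tau> t))" for Q
    proof -
      have "(\<Sum>i\<in>blocks g. ?h Q i) = (\<Sum>t<r. ?h Q (\<tau> t))"
        unfolding bl by (subst sum.reindex[OF inj]) (simp add: o_def)
      then show ?thesis
        unfolding count_def sum.subset_diff[OF sub finite_lessThan, of "?h Q"] by (rule arg_cong)
    qed
    have "(\<Sum>i\<in>{..<n} - blocks g. ?h (P \<circ> \<Phi>) i) = (\<Sum>i\<in>{..<n} - blocks g. ?h P i)"
    proof (intro sum.cong refl)
      fix i assume "i \<in> {..<n} - blocks g"
      then have "i \<notin> blocks g" by blast
      then show "?h (P \<circ> \<Phi>) i = ?h P i" by (simp only: o_def \<Phi>2[OF \<open>i \<notin> blocks g\<close>])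
    qed
    moreover have "(\<Sum>t<r. ?h (P \<circ> \<Phi>) (\<tau> t)) = (\<Sum>t<r. copy_count (\<lambda>a. P (shift t (g a))) s)"
      by (simp add: \<Phi>1)
    ultimately show ?thesis
      unfolding split delta_def by (simp add: \<tau>_def)
  qed
  show ?thesis
    by (rule that[OF bij _ cnt], unfold o_def, rule arg_cong[of _ _ P], rule \<Phi>2)
qed

text \<open>Availability in many disjoint places, phrased as robustness: no \<open>m\<close> copies
  block all proper moves of value \<open>v\<close>. Disjoint moves can then be picked
  greedily.\<close>

definition frequent :: "(nat \<times> nat \<Rightarrow> nat) \<Rightarrow> nat \<Rightarrow> ('c \<Rightarrow> int) \<Rightarrow> bool" where
  "frequent P m v \<longleftrightarrow> (\<forall>W \<subseteq> {..<n}. card W \<le> m \<longrightarrow>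
     (\<exists>g\<in>moves. proper g \<and> blocks g \<inter> W = {} \<and> restrict (delta P g) S = v))"

text \<open>Shifts do not leave a copy, so a move reads \<open>P\<close> only in the copies that it
  meets.\<close>

lemma delta_cong:
  assumes "g \<in> moves" "\<And>i z. i \<in> blocks g \<Longrightarrow> P' (i, z) = P (i, z)"
  shows "delta P' g s = delta P g s"
proof -
  have "copy_count (\<lambda>a. P' (shift t (g a))) s = copy_count (\<lambda>a. P (shift t (g a))) s" for t
    unfolding copy_count_def
  proof (intro sum.cong refl)
    fix e assume "e \<in> E"
    then have "e \<subseteq> {..<r}" using E by (auto simp: nsets_def)
    then have "(\<lambda>a. P' (shift t (g a))) ` e = (\<lambda>a. P (shift t (g a))) ` e"
      by (intro image_cong refl) (auto simp: shift_def assms(2))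
    then show "of_bool (c ((\<lambda>a. P' (shift t (g a))) ` e) = s) =
        (of_bool (c ((\<lambda>a. P (shift t (g a))) ` e) = s) :: int)" by simp
  qed
  moreover have "copy_count (\<lambda>z. P' (fst (g a), z)) s = copy_count (\<lambda>z. P (fst (g a), z)) s"
    if "a < r" for a
    using that by (simp add: assms(2))
  ultimately show ?thesis by (simp add: delta_def)
qed

text \<open>Greedy choice: each move spoils at most \<open>r\<close> copies, so up to
  \<open>m\<close> moves spoil at most \<open>r * m\<close>, and a frequent value is still available
  in untouched copies.\<close>

lemma apply_moves:
  assumes P: "bij_betw P cells {..<n * r}" and "finite V"
    and V: "\<And>v. v \<in> V \<Longrightarrow> frequent P (r * m) v" and "(\<Sum>v\<in>V. a v) \<le> m"
  obtains P' where "bij_betw P' cells {..<n * r}"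
    and "\<And>s. s \<in> S \<Longrightarrow> count P' s = count P s + (\<Sum>v\<in>V. int (a v) * v s)"
proof -
  \<comment> \<open>The induction also records the set \<open>W\<close> of touched copies, outside
    which the bijection is still \<open>P\<close>.\<close>
  have "\<exists>P' W. bij_betw P' cells {..<n * r} \<and> W \<subseteq> {..<n} \<and> card W \<le> r * k \<and>
      (\<forall>i z. i \<notin> W \<longrightarrow> P' (i, z) = P (i, z)) \<and>
      (\<forall>s\<in>S. count P' s = count P s + (\<Sum>v\<in>V. int (a v) * v s))"
    if "(\<Sum>v\<in>V. a v) = k" "k \<le> m" for k a
    using that
  proof (induction k arbitrary: a)
    case 0
    then show ?case
      using P \<open>finite V\<close> by (intro exI[of _ P] exI[of _ "{}"]) simp
  next
    case (Suc k)
    then obtain v where v: "v \<in> V" "a v > 0"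
      using \<open>finite V\<close> by (metis gr0I sum.neutral nat.distinct(1))
    define a' where "a' = a(v := a v - 1)"
    have upd: "(\<Sum>u\<in>V. F (a u) u) = F (a v) v + (\<Sum>u\<in>V - {v}. F (a' u) u)"
      for F :: "nat \<Rightarrow> ('c \<Rightarrow> int) \<Rightarrow> int"
      using v \<open>finite V\<close> by (simp add: sum.remove a'_def)
    have upd': "(\<Sum>u\<in>V. F (a' u) u) = F (a v - 1) v + (\<Sum>u\<in>V - {v}. F (a' u) u)"
      for F :: "nat \<Rightarrow> ('c \<Rightarrow> int) \<Rightarrow> int"
      using v \<open>finite V\<close> by (simp add: sum.remove a'_def)
    have "int (\<Sum>u\<in>V. a u) = int (\<Sum>u\<in>V. a' u) + 1"
      using upd[of "\<lambda>x _. int x"] upd'[of "\<lambda>x _. int x"] v by simp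
    then have "(\<Sum>u\<in>V. a' u) = k" "k \<le> m"
      using Suc.prems by linarith+
    from Suc.IH[OF this] obtain P1 W where P1: "bij_betw P1 cells {..<n * r}"
      and W: "W \<subseteq> {..<n}" "card W \<le> r * k"
      and P1W: "\<And>i z. i \<notin> W \<Longrightarrow> P1 (i, z) = P (i, z)"
      and cnt: "\<And>s. s \<in> S \<Longrightarrow> count P1 s = count P s + (\<Sum>v\<in>V. int (a' v) * v s)"
      by blast
    have "card W \<le> r * m"
      using W(2) \<open>k \<le> m\<close> by (meson mult_le_mono2 order_trans)
    then obtain g where g: "g \<in> moves" "proper g" "blocks g \<inter> W = {}" "restrict (delta P g) S = v"
      using V[OF v(1)] W(1) unfolding frequent_def by blast
    obtain P2 where P2: "bij_betw P2 cells {..<n * r}"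
      and P2g: "\<And>i z. i \<notin> blocks g \<Longrightarrow> P2 (i, z) = P1 (i, z)"
      and cnt2: "\<And>s. count P2 s = count P1 s + delta P1 g s"
      using apply_move[OF P1 g(1,2)] by blast
    note blocks_subset[OF g(1)]
    moreover have "card (W \<union> blocks g) \<le> r * Suc k"
      using card_Un_le[of W "blocks g"] card_image_le[of "{..<r}" "\<lambda>a. fst (g a)"] W(2) by simp
    moreover have "count P2 s = count P s + (\<Sum>v\<in>V. int (a v) * v s)" if "s \<in> S" for s
    proof -
      \<comment> \<open>The value of \<open>g\<close> was taken with respect to \<open>P\<close>,
        but it is the same for \<open>P1\<close> since \<open>g\<close> avoids the touched
        copies.\<close>
      have "delta P1 g s = delta P g s"
        using g(3) P1W by (intro delta_cong[OF g(1)]) blast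
      also have "\<dots> = v s" using g(4) that by (metis restrict_apply')
      finally show ?thesis
        using upd[of "\<lambda>x u. int x * u s"] upd'[of "\<lambda>x u. int x * u s"] v(2)
        by (simp add: cnt2 cnt[OF that] of_nat_diff algebra_simps)
    qed
    ultimately show ?case
      using P2 W(1) P2g P1W
      by (intro exI[of _ P2] exI[of _ "W \<union> blocks g"] conjI ballI allI impI) auto
  qed
  from this[OF refl assms(4)] obtain P' where P': "bij_betw P' cells {..<n * r}"
    and cnt: "\<forall>s\<in>S. count P' s = count P s + (\<Sum>v\<in>V. int (a v) * v s)"
    by (elim exE conjE)
  show ?thesis by (rule that[OF P']) (rule bspec[OF cnt])
qed

section \<open>Approximating the average by frequent values\<close>

text \<open>This is \<open>n * card E\<close> times the probability that two independent uniform
  vertices form an edge of colour \<open>s\<close>. It is the count at which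
  \<open>sum_delta\<close> vanishes.\<close>

definition target :: "'c \<Rightarrow> real" where
  "target s = 2 * card E / (real n * real r ^ 2) * total s"

text \<open>Union bound over pairs of roles: once the first cell is fixed, only \<open>r\<close> of
  the \<open>n * r\<close> cells lie in the same copy.\<close>

lemma card_improper_le:
  "card {g\<in>moves. \<not> proper g} \<le> r ^ 2 * ((n * r) ^ (r - 1) * r)"
proof -
  let ?B = "\<lambda>a b. {g\<in>moves. fst (g a) = fst (g b)}"
  let ?I = "{p \<in> {..<r} \<times> {..<r}. fst p \<noteq> snd p}"
  have card: "card (?B a b) = (n * r) ^ (r - 1) * r" if "a < r" "b < r" "a \<noteq> b" for a b
  proof -
    have "card (?B a b) = (\<Sum>g\<in>moves. of_bool (fst (g a) = fst (g b)))"
      using finite_moves by (simp add: sum.If_cases of_bool_def Int_def)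
    also have "\<dots> = (n * r) ^ (r - 2) * (\<Sum>x\<in>cells. \<Sum>y\<in>cells. of_bool (fst x = fst y))"
      unfolding moves_def using that
      by (subst sum_PiE_pair[where F = "\<lambda>x y. of_bool (fst x = fst y)"])
         (auto simp: finite_cells card_cells)
    also have "(\<Sum>x\<in>cells. \<Sum>y\<in>cells. of_bool (fst x = fst y)) = (\<Sum>x\<in>cells. r)"
    proof (intro sum.cong refl)
      fix x assume "x \<in> cells"
      then show "(\<Sum>y\<in>cells. of_bool (fst x = fst y)) = r"
        using sum_cells_fst[of "\<lambda>i. of_bool (fst x = i) :: nat"]
        by (auto simp: of_bool_def cells_def)
    qed
    also have "(n * r) ^ (r - 2) * (\<Sum>x\<in>cells. r) = (n * r) ^ Suc (r - 2) * r"
      by (simp add: card_cells algebra_simps)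
    also have "Suc (r - 2) = r - 1"
      using r_ge by simp
    finally show ?thesis .
  qed
  have "{g\<in>moves. \<not> proper g} \<subseteq> (\<Union>p\<in>?I. ?B (fst p) (snd p))"
    by (auto simp: inj_on_def)
  then have "card {g\<in>moves. \<not> proper g} \<le> card (\<Union>p\<in>?I. ?B (fst p) (snd p))"
    using finite_moves by (intro card_mono) auto
  also have "\<dots> \<le> (\<Sum>p\<in>?I. card (?B (fst p) (snd p)))"
    by (intro card_UN_le) auto
  also have "\<dots> = (\<Sum>p\<in>?I. (n * r) ^ (r - 1) * r)"
    by (intro sum.cong refl card) auto
  also have "\<dots> \<le> r ^ 2 * ((n * r) ^ (r - 1) * r)"
    using card_mono[of "{..<r} \<times> {..<r}" ?I] by (simp add: power2_eq_square)
  finally show ?thesis .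
qed

text \<open>Union bound over the role whose cell lies in a copy from \<open>W\<close>.\<close>

lemma card_hitting_le:
  assumes "W \<subseteq> {..<n}"
  shows "card {g\<in>moves. blocks g \<inter> W \<noteq> {}} \<le> r ^ 2 * ((n * r) ^ (r - 1) * card W)"
proof -
  have card: "card {g\<in>moves. fst (g a) \<in> W} = (n * r) ^ (r - 1) * (r * card W)" if "a < r" for a
  proof -
    have "card {g\<in>moves. fst (g a) \<in> W} = (\<Sum>g\<in>moves. of_bool (fst (g a) \<in> W))"
      using finite_moves by (simp add: sum.If_cases of_bool_def Int_def)
    also have "\<dots> = (n * r) ^ (r - 1) * (\<Sum>x\<in>cells. of_bool (fst x \<in> W))"
      unfolding moves_def using that
      by (subst sum_PiE_single[where F = "\<lambda>x. of_bool (fst x \<in> W)"])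
         (auto simp: finite_cells card_cells)
    also have "(\<Sum>x\<in>cells. of_bool (fst x \<in> W)) = r * card W"
      using sum_cells_fst[of "\<lambda>i. of_bool (i \<in> W) :: nat"] assms
      by (simp add: sum.If_cases of_bool_def Int_absorb1)
    finally show ?thesis .
  qed
  have "{g\<in>moves. blocks g \<inter> W \<noteq> {}} \<subseteq> (\<Union>a<r. {g\<in>moves. fst (g a) \<in> W})"
    by auto
  then have "card {g\<in>moves. blocks g \<inter> W \<noteq> {}} \<le> card (\<Union>a<r. {g\<in>moves. fst (g a) \<in> W})"
    using finite_moves by (intro card_mono) auto
  also have "\<dots> \<le> (\<Sum>a<r. card {g\<in>moves. fst (g a) \<in> W})"
    by (intro card_UN_le) auto
  also have "\<dots> = r ^ 2 * ((n * r) ^ (r - 1) * card W)"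
    by (simp add: card power2_eq_square)
  finally show ?thesis .
qed

lemma obtain_blocking_set:
  assumes "\<not> frequent P m v"
  obtains W where "W \<subseteq> {..<n}" "card W \<le> m"
    and "\<And>g. g \<in> moves \<Longrightarrow> proper g \<Longrightarrow> restrict (delta P g) S = v \<Longrightarrow> blocks g \<inter> W \<noteq> {}"
  using assms unfolding frequent_def by blast

text \<open>Every value that is not frequent has a blocking set of at most \<open>m\<close> copies.
  Proper moves avoiding the union of these sets have frequent values only and are grouped by value
  into \<open>lam\<close>. The remaining moves are few enough that their share of the average is
  bounded independently of \<open>n\<close>.\<close>

lemma average_move:
  assumes P: "bij_betw P cells {..<n * r}"
  obtains V and lam :: "('c \<Rightarrow> int) \<Rightarrow> real"
  where "finite V" "card V \<le> r ^ (3 * card S)"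
    and "\<And>v. v \<in> V \<Longrightarrow> frequent P m v"
    and "\<And>v. v \<in> V \<Longrightarrow> 0 \<le> lam v"
    and "\<And>v s. v \<in> V \<Longrightarrow> s \<in> S \<Longrightarrow> 2 * \<bar>v s\<bar> \<le> r ^ 3"
    and "\<And>v. v \<in> V \<Longrightarrow> (\<Sum>s\<in>S. \<bar>v s\<bar>) \<le> r ^ 3"
    and "(\<Sum>s\<in>S. \<bar>count P s - target s + (\<Sum>v\<in>V. lam v * v s)\<bar>)
      \<le> real (r ^ 3 * (r + r ^ (3 * card S) * m))"
proof -
  define val where "val g = restrict (delta P g) S" for g
  define X where "X = val ` moves"
  define V where "V = {v\<in>X. frequent P m v}"
  define W where "W v = (SOME W. W \<subseteq> {..<n} \<and> card W \<le> m \<and>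
    (\<forall>g\<in>moves. proper g \<and> val g = v \<longrightarrow> blocks g \<inter> W \<noteq> {}))" for v
  define WW where "WW = (\<Union>v\<in>X - V. W v)"
  define good where "good = {g\<in>moves. proper g \<and> blocks g \<inter> WW = {}}"
  define bad where "bad = moves - good"
  \<comment> \<open>This is the coefficient of \<open>count P s\<close> in \<open>sum_delta\<close>;
    division by it turns the sum over all moves into \<open>target s - count P s\<close>.\<close>
  define D :: real where "D = real r ^ 2 * real (n * r) ^ (r - 1)"
  define lam where "lam v = real (card {g\<in>good. val g = v}) / D" for v
  have D_pos: "D > 0" using n_pos r_ge by (simp add: D_def)
  have fin: "finite X" "finite V" "finite good" "finite bad"
    using finite_moves by (auto simp: X_def V_def good_def bad_def)
  have delta_le: "2 * \<bar>delta P g s\<bar> \<le> int (r ^ 3)" for g s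
    using abs_delta_le[of P g s] of_nat_mono[OF move_size_le, where 'a = int] by simp
  have delta_sum_le: "(\<Sum>s\<in>S. \<bar>delta P g s\<bar>) \<le> int (r ^ 3)" for g
    using sum_abs_delta_le[of P g] of_nat_mono[OF move_size_le, where 'a = int] by simp
  have card_X: "card X \<le> r ^ (3 * card S)"
  proof -
    let ?e = "int (r * card E)"
    have "val g \<in> S \<rightarrow>\<^sub>E {- ?e..?e}" for g
    proof -
      have "- ?e \<le> delta P g s \<and> delta P g s \<le> ?e" for s
        using abs_delta_le[of P g s] by linarith
      then show ?thesis by (simp add: val_def restrict_PiE_iff)
    qed
    then have "X \<subseteq> S \<rightarrow>\<^sub>E {- ?e..?e}" by (auto simp: X_def)
    then have "card X \<le> card (S \<rightarrow>\<^sub>E {- ?e..?e})"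
      using fin_S by (intro card_mono finite_PiE) auto
    also have "\<dots> = (2 * r * card E + 1) ^ card S"
      using fin_S by (simp add: card_PiE nat_add_distrib nat_mult_distrib algebra_simps)
    also have "\<dots> \<le> (r ^ 3) ^ card S"
      by (intro power_mono move_size_le) auto
    finally show ?thesis by (simp add: power_mult)
  qed
  have W: "W v \<subseteq> {..<n} \<and> card (W v) \<le> m \<and>
      (\<forall>g\<in>moves. proper g \<and> val g = v \<longrightarrow> blocks g \<inter> W v \<noteq> {})" if "v \<in> X - V" for v
  proof -
    have "\<not> frequent P m v" using that by (auto simp: V_def)
    from obtain_blocking_set[OF this] obtain W0 where "W0 \<subseteq> {..<n} \<and> card W0 \<le> m \<and>
      (\<forall>g\<in>moves. proper g \<and> val g = v \<longrightarrow> blocks g \<inter> W0 \<noteq> {})"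
      unfolding val_def by metis
    then show ?thesis unfolding W_def by (rule someI)
  qed
  have WW_sub: "WW \<subseteq> {..<n}" using W by (fastforce simp: WW_def)
  have card_WW: "card WW \<le> r ^ (3 * card S) * m"
  proof -
    have "card WW \<le> (\<Sum>v\<in>X - V. card (W v))"
      unfolding WW_def using fin by (intro card_UN_le) auto
    also have "\<dots> \<le> (\<Sum>v\<in>X - V. m)" using W by (intro sum_mono) blast
    also have "\<dots> \<le> card X * m" using fin by (simp add: card_mono)
    also have "\<dots> \<le> r ^ (3 * card S) * m" using card_X by simp
    finally show ?thesis .
  qed
  have good_V: "val ` good \<subseteq> V"
  proof (rule image_subsetI, rule ccontr)
    fix g assume g: "g \<in> good" "val g \<notin> V"
    then have "val g \<in> X - V" by (auto simp: X_def good_def)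
    with W[OF this] g show False by (auto simp: good_def WW_def)
  qed
  have card_bad: "card bad \<le> D * (r + card WW)"
  proof -
    have "bad \<subseteq> {g\<in>moves. \<not> proper g} \<union> {g\<in>moves. blocks g \<inter> WW \<noteq> {}}"
      by (auto simp: bad_def good_def)
    then have "card bad \<le> card {g\<in>moves. \<not> proper g} + card {g\<in>moves. blocks g \<inter> WW \<noteq> {}}"
      using finite_moves by (intro order_trans[OF card_mono card_Un_le]) auto
    also have "\<dots> \<le> r ^ 2 * ((n * r) ^ (r - 1) * r) + r ^ 2 * ((n * r) ^ (r - 1) * card WW)"
      by (intro add_mono card_improper_le card_hitting_le WW_sub)
    also have "\<dots> = (r ^ 2 * (n * r) ^ (r - 1)) * (r + card WW)"
      by (simp add: algebra_simps)
    finally have "real (card bad) \<le> real ((r ^ 2 * (n * r) ^ (r - 1)) * (r + card WW))"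
      by (rule of_nat_mono)
    then show ?thesis by (simp add: D_def)
  qed
  have dev: "count P s - target s + (\<Sum>v\<in>V. lam v * v s) = - (\<Sum>g\<in>bad. delta P g s) / D"
    if s: "s \<in> S" for s
  proof -
    have "D * (\<Sum>v\<in>V. lam v * v s) = (\<Sum>v\<in>V. \<Sum>g\<in>{g\<in>good. val g = v}. real_of_int (delta P g s))"
      unfolding sum_distrib_left
    proof (intro sum.cong refl)
      fix v
      have "(\<Sum>g\<in>{g\<in>good. val g = v}. real_of_int (delta P g s)) = (\<Sum>g\<in>{g\<in>good. val g = v}. real_of_int (v s))"
        using s by (intro sum.cong) (auto simp: val_def)
      then show "D * (lam v * v s) = (\<Sum>g\<in>{g\<in>good. val g = v}. real_of_int (delta P g s))"
        using D_pos by (simp add: lam_def)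
    qed
    also have "\<dots> = (\<Sum>g\<in>good. real_of_int (delta P g s))"
      using fin good_V by (intro sum.group) auto
    finally have good: "D * (\<Sum>v\<in>V. lam v * v s) = (\<Sum>g\<in>good. real_of_int (delta P g s))" .
    have "(\<Sum>g\<in>moves. real_of_int (delta P g s)) =
        2 * real r * real (card E) * real (n * r) ^ (r - 2) * total s - D * count P s"
      using arg_cong[OF sum_delta[OF P s], of real_of_int] by (simp add: D_def)
    also have "2 * real r * real (card E) * real (n * r) ^ (r - 2) * total s = D * target s"
    proof -
      have "r - 1 = Suc (r - 2)" using r_ge by simp
      then show ?thesis
        using n_pos r_ge by (simp add: D_def target_def field_simps power2_eq_square)
    qed
    also have "(\<Sum>g\<in>moves. real_of_int (delta P g s)) =
        (\<Sum>g\<in>bad. real_of_int (delta P g s)) + (\<Sum>g\<in>good. real_of_int (delta P g s))"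
      unfolding bad_def by (rule sum.subset_diff) (auto simp: good_def finite_moves)
    finally have "D * (count P s - target s + (\<Sum>v\<in>V. lam v * v s)) = - (\<Sum>g\<in>bad. real_of_int (delta P g s))"
      using good by (simp add: algebra_simps)
    then show ?thesis
      using D_pos by (simp add: field_simps)
  qed
  have "(\<Sum>s\<in>S. \<bar>count P s - target s + (\<Sum>v\<in>V. lam v * v s)\<bar>) =
      (\<Sum>s\<in>S. \<bar>\<Sum>g\<in>bad. real_of_int (delta P g s)\<bar>) / D"
    unfolding sum_divide_distrib[of _ S] using D_pos by (intro sum.cong refl) (simp add: dev)
  also have "\<dots> \<le> (D * (r + card WW) * real (r ^ 3)) / D"
  proof (rule divide_right_mono)
    have "(\<Sum>s\<in>S. \<bar>\<Sum>g\<in>bad. real_of_int (delta P g s)\<bar>) \<le> (\<Sum>s\<in>S. \<Sum>g\<in>bad. \<bar>real_of_int (delta P g s)\<bar>)"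
      by (intro sum_mono sum_abs)
    also have "\<dots> = (\<Sum>g\<in>bad. \<Sum>s\<in>S. \<bar>real_of_int (delta P g s)\<bar>)"
      by (rule sum.swap)
    also have "\<dots> \<le> (\<Sum>g\<in>bad. real (r ^ 3))"
    proof (intro sum_mono)
      fix g
      have "real_of_int (\<Sum>s\<in>S. \<bar>delta P g s\<bar>) \<le> real_of_int (int (r ^ 3))"
        using delta_sum_le by (simp only: of_int_le_iff)
      then show "(\<Sum>s\<in>S. \<bar>real_of_int (delta P g s)\<bar>) \<le> real (r ^ 3)" by simp
    qed
    also have "\<dots> = real (card bad) * real (r ^ 3)" by simp
    also have "\<dots> \<le> D * (r + card WW) * real (r ^ 3)"
      using card_bad by (intro mult_right_mono) auto
    finally show "(\<Sum>s\<in>S. \<bar>\<Sum>g\<in>bad. real_of_int (delta P g s)\<bar>) \<le> D * (r + card WW) * real (r ^ 3)" .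
  qed (use D_pos in simp)
  also have "\<dots> = real (r ^ 3 * (r + card WW))"
    using D_pos by simp
  also have "\<dots> \<le> real (r ^ 3 * (r + r ^ (3 * card S) * m))"
    using card_WW by (intro of_nat_mono mult_left_mono add_left_mono) auto
  finally show ?thesis
  proof (intro that[of V lam])
    show "card V \<le> r ^ (3 * card S)"
      using card_mono[OF fin(1), of V] card_X by (auto simp: V_def)
    show "2 * \<bar>v s\<bar> \<le> int (r ^ 3)" if "v \<in> V" "s \<in> S" for v s
      using that delta_le by (auto simp: V_def X_def val_def)
    show "(\<Sum>s\<in>S. \<bar>v s\<bar>) \<le> int (r ^ 3)" if "v \<in> V" for v
      using that delta_sum_le by (auto simp: V_def X_def val_def)
  qed (use fin D_pos in \<open>auto simp: V_def lam_def\<close>)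
qed

section \<open>Descent of the l1 deviation from the target\<close>

definition deviation :: "(nat \<times> nat \<Rightarrow> nat) \<Rightarrow> real" where
  "deviation P = (\<Sum>s\<in>S. \<bar>count P s - target s\<bar>)"

end

text \<open>At most \<open>r ^ (3 * k)\<close> values occur, each of l1 norm at most
  \<open>r ^ 3\<close>, and each multiplicity is rounded by at most 1.\<close>

definition rounding_error :: "nat \<Rightarrow> nat \<Rightarrow> nat" where
  "rounding_error r k = r ^ (3 * k) * r ^ 3"

text \<open>Half a step has to exceed the rounding error.\<close>

definition step_length :: "nat \<Rightarrow> nat \<Rightarrow> nat" where
  "step_length r k = 2 * rounding_error r k + 1"

text \<open>The number of values times the largest multiplicity of one value in a step, as given by
  \<open>bounded_cone_representation\<close>.\<close>

definition step_moves :: "nat \<Rightarrow> nat \<Rightarrow> nat" where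
  "step_moves r k = r ^ (3 * k) * ((r ^ 3) ^ (2 ^ k - 1) * step_length r k)"

text \<open>The error in \<open>average_move\<close> when frequency is required against
  \<open>r * step_moves r k\<close> copies, the number that one step may touch.\<close>

definition averaging_error :: "nat \<Rightarrow> nat \<Rightarrow> nat" where
  "averaging_error r k = r ^ 3 * (r + r ^ (3 * k) * (r * step_moves r k))"

definition deviation_bound :: "nat \<Rightarrow> nat \<Rightarrow> nat" where
  "deviation_bound r k = step_length r k + 3 * averaging_error r k"

context factor_colouring
begin

text \<open>The cone vector \<open>w\<close> is within \<open>err\<close> of \<open>- dv\<close>.
  The piece of \<open>w\<close> of l1 length \<open>T\<close> is rounded and realised by disjoint
  moves; it gains at least \<open>T / 2\<close>, while rounding costs at most \<open>q\<close> with
  \<open>T = 2 * q + 1\<close>.\<close>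

lemma deviation_descent:
  assumes P: "bij_betw P cells {..<n * r}"
    and large: "deviation P > deviation_bound r (card S)"
  obtains P' where "bij_betw P' cells {..<n * r}" "deviation P' < deviation P"
proof -
  define q where "q = real (rounding_error r (card S))"
  define T where "T = real (step_length r (card S))"
  define m where "m = step_moves r (card S)"
  define err where "err = real (averaging_error r (card S))"
  define K where "K = (real r ^ 3) ^ (2 ^ card S - 1)"
  define R where "R = deviation P"
  have T: "T = 2 * q + 1" by (simp add: T_def step_length_def q_def)
  have q0: "q \<ge> 0" and e0: "err \<ge> 0" by (auto simp: q_def err_def)
  have R: "R > T + 3 * err"
    using large by (simp add: R_def deviation_bound_def T_def err_def)
  obtain V and lam :: "('c \<Rightarrow> int) \<Rightarrow> real" where V: "finite V" "card V \<le> r ^ (3 * card S)"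
    and freq: "\<And>v. v \<in> V \<Longrightarrow> frequent P (r * m) v"
    and lam: "\<And>v. v \<in> V \<Longrightarrow> 0 \<le> lam v"
    and v_le: "\<And>v s. v \<in> V \<Longrightarrow> s \<in> S \<Longrightarrow> 2 * \<bar>v s\<bar> \<le> r ^ 3"
    and v_sum: "\<And>v. v \<in> V \<Longrightarrow> (\<Sum>s\<in>S. \<bar>v s\<bar>) \<le> r ^ 3"
    and avg: "(\<Sum>s\<in>S. \<bar>count P s - target s + (\<Sum>v\<in>V. lam v * v s)\<bar>)
      \<le> real (r ^ 3 * (r + r ^ (3 * card S) * (r * m)))"
    using average_move[OF P] by blast
  define dv where "dv s = count P s - target s" for s
  define w where "w s = (\<Sum>v\<in>V. lam v * v s)" for s
  define w1 where "w1 = (\<Sum>s\<in>S. \<bar>w s\<bar>)"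
  have avg': "(\<Sum>s\<in>S. \<bar>dv s + w s\<bar>) \<le> err"
    using avg by (simp add: dv_def w_def err_def averaging_error_def m_def)
  have R_eq: "R = (\<Sum>s\<in>S. \<bar>dv s\<bar>)"
    by (simp add: R_def deviation_def dv_def)
  have "w1 \<le> (\<Sum>s\<in>S. \<bar>dv s + w s\<bar> + \<bar>dv s\<bar>)"
    unfolding w1_def by (intro sum_mono) linarith
  then have w1_le: "w1 \<le> R + err"
    using avg' by (simp add: R_eq sum.distrib)
  have "R \<le> (\<Sum>s\<in>S. \<bar>dv s + w s\<bar> + \<bar>w s\<bar>)"
    unfolding R_eq by (intro sum_mono) linarith
  then have w1_ge: "R - err \<le> w1"
    using avg' by (simp add: w1_def sum.distrib)
  have w1_T: "T \<le> w1" using R w1_ge e0 by linarith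
  have w1_pos: "0 < w1" using w1_T T q0 by linarith
  \<comment> \<open>The fraction of \<open>w\<close> to be performed. Its length \<open>T\<close> is
    fixed, so the number of moves does not grow with \<open>n\<close>.\<close>
  define th where "th = T / w1"
  have th: "0 \<le> th" "th \<le> 1" using w1_pos w1_T T q0 by (auto simp: th_def)
  have w_le: "\<bar>w s\<bar> \<le> w1" if "s \<in> S" for s
    unfolding w1_def using that fin_S by (intro member_le_sum) auto
  have B1: "1 \<le> real r ^ 3" using r_ge by (intro one_le_power) simp
  have v_le': "2 * \<bar>real_of_int (v s)\<bar> \<le> real r ^ 3" if "v \<in> V" "s \<in> S" for v s
  proof -
    have "real_of_int (2 * \<bar>v s\<bar>) \<le> real_of_int (int (r ^ 3))"
      using v_le[OF that] by (simp only: of_int_le_iff)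
    then show ?thesis by simp
  qed
  have "\<exists>mu :: ('c \<Rightarrow> int) \<Rightarrow> real. (\<forall>v\<in>V. 0 \<le> mu v \<and> mu v \<le> K * w1) \<and>
      (\<forall>s\<in>S. (\<Sum>v\<in>V. mu v * v s) = w s)"
    unfolding K_def w_def
  proof (rule bounded_cone_representation[of S V lam "\<lambda>v. v" "real r ^ 3" w1])
    show "\<bar>\<Sum>v\<in>V. lam v * v s\<bar> \<le> w1" if "s \<in> S" for s
      using w_le[OF that] by (simp add: w_def)
  next
    fix mu :: "('c \<Rightarrow> int) \<Rightarrow> real"
    assume mu: "\<And>v. v \<in> V \<Longrightarrow> 0 \<le> mu v"
      "\<And>v. v \<in> V \<Longrightarrow> mu v \<le> (real r ^ 3) ^ (2 ^ card S - 1) * w1"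
      "\<And>s. s \<in> S \<Longrightarrow> (\<Sum>v\<in>V. mu v * v s) = (\<Sum>v\<in>V. lam v * v s)"
    show "\<exists>mu :: ('c \<Rightarrow> int) \<Rightarrow> real.
        (\<forall>v\<in>V. 0 \<le> mu v \<and> mu v \<le> (real r ^ 3) ^ (2 ^ card S - 1) * w1) \<and>
        (\<forall>s\<in>S. (\<Sum>v\<in>V. mu v * v s) = (\<Sum>v\<in>V. lam v * v s))"
      using mu by (intro exI[of _ mu] conjI ballI)
  qed (use fin_S V(1) lam v_le' B1 w1_pos in simp_all)
  then obtain mu :: "('c \<Rightarrow> int) \<Rightarrow> real" where mu0: "\<And>v. v \<in> V \<Longrightarrow> 0 \<le> mu v"
    and mu_le: "\<And>v. v \<in> V \<Longrightarrow> mu v \<le> K * w1"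
    and mu: "\<And>s. s \<in> S \<Longrightarrow> (\<Sum>v\<in>V. mu v * v s) = w s"
    by blast
  \<comment> \<open>Rounding down gives integer multiplicities; the fractional parts
    \<open>fr\<close> are charged to \<open>q\<close>.\<close>
  define a where "a v = nat \<lfloor>mu v * th\<rfloor>" for v
  define fr where "fr v = mu v * th - real (a v)" for v
  have fr: "\<bar>fr v\<bar> \<le> 1" and a_le: "real (a v) \<le> K * T" if "v \<in> V" for v
  proof -
    have nn: "0 \<le> mu v * th" using mu0[OF that] th by simp
    then have fl: "real (a v) = of_int \<lfloor>mu v * th\<rfloor>" by (simp add: a_def)
    show "\<bar>fr v\<bar> \<le> 1" unfolding fr_def fl by linarith
    have "real (a v) \<le> mu v * th" unfolding fl by simp
    also have "\<dots> \<le> K * w1 * th" using mu_le[OF that] th by (intro mult_right_mono)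
    also have "\<dots> = K * T" using w1_pos by (simp add: th_def)
    finally show "real (a v) \<le> K * T" .
  qed
  have "real (\<Sum>v\<in>V. a v) \<le> card V * (K * T)"
    using sum_bounded_above[of V "\<lambda>v. real (a v)" "K * T"] a_le by simp
  also have "\<dots> \<le> real (r ^ (3 * card S)) * (K * T)"
    using V(2) T q0 by (intro mult_right_mono of_nat_mono) (simp_all add: K_def)
  also have "\<dots> = real m"
    by (simp add: m_def step_moves_def K_def T_def)
  finally have "(\<Sum>v\<in>V. a v) \<le> m" by (simp only: of_nat_le_iff)
  from apply_moves[OF P V(1) freq this] obtain P' where P': "bij_betw P' cells {..<n * r}"
    and cnt: "\<And>s. s \<in> S \<Longrightarrow> count P' s = count P s + (\<Sum>v\<in>V. int (a v) * v s)"
    by blast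
  \<comment> \<open>The new deviation is a convex combination of the old one and of the small vector
    \<open>dv + w\<close>, up to the rounding term.\<close>
  have dv': "count P' s - target s = (1 - th) * dv s + th * (dv s + w s) - (\<Sum>v\<in>V. fr v * v s)"
    if "s \<in> S" for s
  proof -
    have "(\<Sum>v\<in>V. fr v * v s) = th * w s - (\<Sum>v\<in>V. real (a v) * v s)"
      by (simp add: fr_def mu[OF that, symmetric] sum_distrib_left sum_subtractf algebra_simps)
    then show ?thesis
      by (simp add: cnt[OF that] dv_def algebra_simps)
  qed
  have "deviation P' \<le> (\<Sum>s\<in>S. (1 - th) * \<bar>dv s\<bar> + th * \<bar>dv s + w s\<bar> + (\<Sum>v\<in>V. \<bar>real_of_int (v s)\<bar>))"
    unfolding deviation_def
  proof (intro sum_mono)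
    fix s assume s: "s \<in> S"
    have "\<bar>\<Sum>v\<in>V. fr v * v s\<bar> \<le> (\<Sum>v\<in>V. \<bar>real_of_int (v s)\<bar>)"
    proof (rule order_trans[OF sum_abs], rule sum_mono)
      fix v assume "v \<in> V"
      then show "\<bar>fr v * v s\<bar> \<le> \<bar>real_of_int (v s)\<bar>"
        using fr by (simp add: abs_mult mult_left_le_one_le)
    qed
    moreover have "\<bar>(1 - th) * dv s\<bar> = (1 - th) * \<bar>dv s\<bar>" "\<bar>th * (dv s + w s)\<bar> = th * \<bar>dv s + w s\<bar>"
      using th by (simp_all add: abs_mult)
    ultimately show "\<bar>count P' s - target s\<bar> \<le>
        (1 - th) * \<bar>dv s\<bar> + th * \<bar>dv s + w s\<bar> + (\<Sum>v\<in>V. \<bar>real_of_int (v s)\<bar>)"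
      unfolding dv'[OF s] by linarith
  qed
  also have "\<dots> = (1 - th) * R + th * (\<Sum>s\<in>S. \<bar>dv s + w s\<bar>) + (\<Sum>v\<in>V. \<Sum>s\<in>S. \<bar>real_of_int (v s)\<bar>)"
    using sum.swap[of "\<lambda>s v. \<bar>real_of_int (v s)\<bar>" V S]
    by (simp add: sum.distrib sum_distrib_left R_eq)
  also have "\<dots> \<le> (1 - th) * R + th * err + q"
  proof (intro add_mono mult_left_mono avg' th order_refl)
    have "(\<Sum>v\<in>V. \<Sum>s\<in>S. \<bar>real_of_int (v s)\<bar>) \<le> (\<Sum>v\<in>V. real (r ^ 3))"
    proof (intro sum_mono)
      fix v assume "v \<in> V"
      then have "real_of_int (\<Sum>s\<in>S. \<bar>v s\<bar>) \<le> real_of_int (int (r ^ 3))"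
        using v_sum by (simp only: of_int_le_iff)
      then show "(\<Sum>s\<in>S. \<bar>real_of_int (v s)\<bar>) \<le> real (r ^ 3)" by simp
    qed
    also have "\<dots> = real (card V * r ^ 3)" by simp
    also have "\<dots> \<le> q"
      unfolding q_def rounding_error_def using V(2) by (intro of_nat_mono mult_right_mono) auto
    finally show "(\<Sum>v\<in>V. \<Sum>s\<in>S. \<bar>real_of_int (v s)\<bar>) \<le> q" .
  qed (use th in simp)
  also have "\<dots> < R"
  proof -
    \<comment> \<open>This is the purpose of the summand \<open>3 * err\<close> in
      \<open>deviation_bound\<close>: it makes \<open>R + err\<close>, hence \<open>w1\<close>, at
      most \<open>2 * (R - err)\<close>, so the gain \<open>th * (R - err)\<close> is at least
      \<open>T / 2\<close>.\<close>
    have "3 * err \<le> R" using R T q0 by linarith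
    then have "w1 \<le> 2 * (R - err)" using w1_le by (simp add: algebra_simps)
    then have "T * w1 \<le> T * (2 * (R - err))" using T q0 by (intro mult_left_mono) auto
    then have "T \<le> 2 * (th * (R - err))"
      using w1_pos by (simp add: th_def field_simps)
    then have "q < th * (R - err)" using T by linarith
    then show ?thesis by (simp add: algebra_simps)
  qed
  finally show ?thesis
    using that P' by (simp add: R_def)
qed

text \<open>Multiplied by \<open>n * r ^ 2\<close> the deviation is a natural number, so it has a
  minimiser, which the descent forces below the bound.\<close>

lemma exists_small_deviation:
  obtains P where "bij_betw P cells {..<n * r}" "deviation P \<le> deviation_bound r (card S)"
proof -
  define scaled where "scaled P = nat (\<Sum>s\<in>S. \<bar>int (n * r ^ 2) * count P s - 2 * int (card E) * total s\<bar>)" for P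
  have pos: "0 < real (n * r ^ 2)" using n_pos r_ge by simp
  have scaled: "real (scaled P) = real (n * r ^ 2) * deviation P" for P
  proof -
    have "real (scaled P) = (\<Sum>s\<in>S. \<bar>real (n * r ^ 2) * count P s - 2 * real (card E) * total s\<bar>)"
      by (simp add: scaled_def sum_nonneg)
    also have "\<dots> = (\<Sum>s\<in>S. real (n * r ^ 2) * \<bar>count P s - target s\<bar>)"
    proof (intro sum.cong refl)
      fix s
      have "real (n * r ^ 2) * \<bar>count P s - target s\<bar> = \<bar>real (n * r ^ 2) * (count P s - target s)\<bar>"
        by (simp add: abs_mult)
      also have "real (n * r ^ 2) * (count P s - target s) =
          real (n * r ^ 2) * count P s - 2 * real (card E) * total s"
        using n_pos r_ge by (simp add: target_def field_simps)
      finally show "\<bar>real (n * r ^ 2) * count P s - 2 * real (card E) * total s\<bar> =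
          real (n * r ^ 2) * \<bar>count P s - target s\<bar>" by simp
    qed
    finally show ?thesis by (simp add: deviation_def sum_distrib_left)
  qed
  obtain P0 where P0: "bij_betw P0 cells {..<n * r}"
    using finite_same_card_bij[of cells "{..<n * r}"] finite_cells card_cells by auto
  from ex_has_least_nat[of "\<lambda>P. bij_betw P cells {..<n * r}", OF this]
  obtain P where P: "bij_betw P cells {..<n * r}"
    and least: "\<And>P'. bij_betw P' cells {..<n * r} \<Longrightarrow> scaled P \<le> scaled P'"
    by blast
  have "deviation P \<le> deviation_bound r (card S)"
  proof (rule ccontr)
    assume "\<not> ?thesis"
    then obtain P' where "bij_betw P' cells {..<n * r}" "deviation P' < deviation P"
      using deviation_descent[OF P] by force
    then have "real (scaled P') < real (scaled P)" and "scaled P \<le> scaled P'"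
      unfolding scaled using least mult_strict_left_mono[OF _ pos] by blast+
    then show False by simp
  qed
  with P show ?thesis by (rule that)
qed

section \<open>From bijections to factors\<close>

definition factor_edges :: "(nat \<times> nat \<Rightarrow> nat) \<Rightarrow> nat set set" where
  "factor_edges P = (\<Union>i<n. (\<lambda>e. (\<lambda>a. P (i, a)) ` e) ` E)"

lemma inj_cells:
  assumes "bij_betw P cells {..<n * r}" "i < n" "j < n" "a \<in> {..<r}" "b \<in> {..<r}" "P (i, a) = P (j, b)"
  shows "i = j \<and> a = b"
  using inj_onD[OF bij_betw_imp_inj_on[OF assms(1)] assms(6)] assms(2-5) by (simp add: cells_def)

lemma card_copy_edge:
  assumes P: "bij_betw P cells {..<n * r}" and "i < n" "e \<in> E"
  shows "(\<lambda>a. P (i, a)) ` e \<in> nsets {..<n * r} 2"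
proof -
  have e: "e \<subseteq> {..<r}" "card e = 2" "finite e"
    using E assms(3) by (auto simp: nsets_def)
  have "inj_on (\<lambda>a. P (i, a)) e"
    using inj_cells[OF P] e(1) assms(2) by (intro inj_onI) blast
  moreover have "(\<lambda>a. P (i, a)) ` e \<subseteq> {..<n * r}"
    using bij_betw_imp_surj_on[OF P] e(1) assms(2) by (auto simp: cells_def)
  ultimately show ?thesis
    using e by (simp add: nsets_def card_image)
qed

text \<open>Injectivity of \<open>P\<close> keeps the edges of different copies, and different edges
  of one copy, distinct, so the set of edges is counted without loss.\<close>

lemma sum_factor_edges:
  assumes P: "bij_betw P cells {..<n * r}"
  shows "(\<Sum>e\<in>factor_edges P. F e) = (\<Sum>i<n. \<Sum>e\<in>E. F ((\<lambda>a. P (i, a)) ` e))"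
proof -
  let ?f = "\<lambda>(i, e). (\<lambda>a. P (i, a)) ` e"
  have "inj_on ?f ({..<n} \<times> E)"
  proof (rule inj_onI)
    fix x y assume xy: "x \<in> {..<n} \<times> E" "y \<in> {..<n} \<times> E" "?f x = ?f y"
    obtain i e where x: "x = (i, e)" by (cases x)
    obtain j e' where y: "y = (j, e')" by (cases y)
    have *: "{i} \<times> e \<subseteq> cells" "{j} \<times> e' \<subseteq> cells" "e \<noteq> {}"
      using xy E by (auto simp: x y cells_def nsets_def)
    have "P ` ({i} \<times> e) = P ` ({j} \<times> e')"
    proof -
      have "P ` ({i} \<times> e) = (\<lambda>a. P (i, a)) ` e" for i e by force
      then show ?thesis using xy(3) by (simp only: x y prod.case)
    qed
    then have "{i} \<times> e = {j} \<times> e'"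
      by (simp only: inj_on_image_eq_iff[OF bij_betw_imp_inj_on[OF P] *(1,2)])
    then show "x = y" using *(3) by (auto simp: x y times_eq_iff)
  qed
  moreover have "factor_edges P = ?f ` ({..<n} \<times> E)"
    by (auto simp: factor_edges_def)
  ultimately show ?thesis
    by (simp add: sum.reindex sum.cartesian_product case_prod_unfold)
qed

text \<open>The \<open>i\<close>-th copy is the image of \<open>H\<close> under
  \<open>P (i, _)\<close> after the inverse of the labelling \<open>h\<close> of its vertices by
  roles.\<close>

lemma is_factor_factor_edges:
  assumes P: "bij_betw P cells {..<n * r}"
    and h: "bij_betw h {..<r} (verts H)" and H: "edges H = (\<lambda>e. h ` e) ` E"
  shows "is_factor H n (complete_graph (n * r)) ({..<n * r}, factor_edges P)"
proof -
  define D where "D i = ((\<lambda>a. P (i, a)) ` {..<r}, (\<lambda>e. (\<lambda>a. P (i, a)) ` e) ` E)" for i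
  have "graph_iso H (D i)" if "i < n" for i
  proof -
    let ?g = "the_inv_into {..<r} h"
    have g: "bij_betw ?g (verts H) {..<r}"
      by (rule bij_betw_the_inv_into[OF h])
    have p: "bij_betw (\<lambda>a. P (i, a)) {..<r} ((\<lambda>a. P (i, a)) ` {..<r})"
      using P that by (auto simp: bij_betw_def inj_on_def cells_def)
    have "?g ` h ` e = e" if "e \<in> E" for e
    proof -
      have "e \<subseteq> {..<r}" using that E by (auto simp: nsets_def)
      then have "?g ` h ` e = (\<lambda>a. a) ` e"
        unfolding image_image using h
        by (intro image_cong) (auto simp: bij_betw_def the_inv_into_f_f)
      then show ?thesis by simp
    qed
    then have "((\<lambda>a. P (i, a)) \<circ> ?g) ` h ` e = (\<lambda>a. P (i, a)) ` e" if "e \<in> E" for e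
      using that by (simp only: image_comp[symmetric])
    then have "edges (D i) = (\<lambda>e. ((\<lambda>a. P (i, a)) \<circ> ?g) ` e) ` edges H"
      unfolding H D_def image_image[of _ "\<lambda>e. h ` e"] snd_conv by (intro image_cong) simp_all
    then show ?thesis
      unfolding graph_iso_def using bij_betw_trans[OF g p]
      by (intro exI[of _ "(\<lambda>a. P (i, a)) \<circ> ?g"]) (simp add: D_def)
  qed
  moreover have "disjoint_family_on (\<lambda>i. verts (D i)) {..<n}"
    using bij_betw_imp_inj_on[OF P]
    by (auto simp: disjoint_family_on_def D_def cells_def inj_on_def)
  moreover have "{..<n * r} = (\<Union>i<n. verts (D i))"
    unfolding bij_betw_imp_surj_on[OF P, symmetric] by (auto simp: D_def cells_def)
  moreover have "subgraph ({..<n * r}, factor_edges P) (complete_graph (n * r))"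
    using card_copy_edge[OF P]
    by (auto simp: subgraph_def simple_graph_def complete_graph_def factor_edges_def)
  ultimately show ?thesis
    unfolding is_factor_def
    by (intro conjI exI[of _ D]) (auto simp: complete_graph_def D_def factor_edges_def)
qed

end

section \<open>Colour sums, the explicit constant and the theorem\<close>

lemma sum_by_colour:
  fixes c :: "'a \<Rightarrow> 'b :: real_vector"
  assumes "finite S" "\<And>e. e \<in> A \<Longrightarrow> c e \<in> S"
  shows "(\<Sum>e\<in>A. c e) = (\<Sum>s\<in>S. real_of_int (\<Sum>e\<in>A. of_bool (c e = s)) *\<^sub>R s)"
proof -
  have "(\<Sum>e\<in>A. c e) = (\<Sum>e\<in>A. \<Sum>s\<in>S. of_bool (c e = s) *\<^sub>R s)"
    using assms by (intro sum.cong) (auto simp: of_bool_def if_distrib[of "\<lambda>x. x *\<^sub>R _"] cong: if_cong)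
  also have "\<dots> = (\<Sum>s\<in>S. \<Sum>e\<in>A. of_bool (c e = s) *\<^sub>R s)"
    by (rule sum.swap)
  finally show ?thesis by (simp add: scaleR_sum_left)
qed

text \<open>Since \<open>2 \<le> r\<close>, numerical factors are absorbed into powers of
  \<open>r\<close>, leaving a single power whose exponent is of order \<open>2 ^ k\<close>.\<close>

lemma deviation_bound_le:
  assumes "2 \<le> r" "2 \<le> k"
  shows "deviation_bound r k \<le> (8 * (k - 1) * r) ^ ((8 * (k - 1) * r) ^ k)"
proof -
  have r1: "1 \<le> r" using assms by simp
  have r2: "4 \<le> r ^ 2" using power_mono[OF assms(1), of 2] by simp
  define m where "m = step_moves r k"
  have "step_length r k \<le> r ^ 2 * r ^ (3 * k + 3)"
  proof -
    have "step_length r k = 2 * r ^ (3 * k + 3) + 1"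
      by (simp add: step_length_def rounding_error_def power_add)
    also have "\<dots> \<le> 4 * r ^ (3 * k + 3)"
      using one_le_power[OF r1, of "3 * k + 3"] by linarith
    also have "\<dots> \<le> r ^ 2 * r ^ (3 * k + 3)"
      using r2 by (rule mult_le_mono1)
    finally show ?thesis .
  qed
  then have "m \<le> r ^ (3 * k) * ((r ^ 3) ^ (2 ^ k - 1) * (r ^ 2 * r ^ (3 * k + 3)))"
    unfolding m_def step_moves_def by (intro mult_le_mono2)
  also have "\<dots> = r ^ (3 * k + (3 * (2 ^ k - 1) + (2 + (3 * k + 3))))"
    by (simp only: power_add power_mult)
  finally have m_le: "m \<le> r ^ (3 * k + (3 * (2 ^ k - 1) + (2 + (3 * k + 3))))" .
  have T1: "1 \<le> step_length r k" by (simp add: step_length_def)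
  have m_ge: "step_length r k \<le> m"
  proof -
    have "1 * (1 * step_length r k) \<le> m"
      unfolding m_def step_moves_def using r1
      by (intro mult_le_mono order_refl one_le_power) auto
    then show ?thesis by simp
  qed
  define e where "e = averaging_error r k"
  have m_e: "m \<le> e"
  proof -
    have "1 * (0 + 1 * (1 * m)) \<le> e"
      unfolding e_def averaging_error_def m_def using r1
      by (intro mult_le_mono add_mono order_refl one_le_power) auto
    then show ?thesis by simp
  qed
  have "e = r ^ 3 * (r * 1 + r ^ (3 * k) * (r * m))"
    by (simp add: e_def averaging_error_def m_def)
  also have "\<dots> \<le> r ^ 3 * (r ^ (3 * k) * (r * m) + r ^ (3 * k) * (r * m))"
  proof (intro mult_le_mono2 add_right_mono)
    have "1 * (r * 1) \<le> r ^ (3 * k) * (r * m)"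
      using r1 T1 m_ge by (intro mult_le_mono order_refl one_le_power) auto
    then show "r * 1 \<le> r ^ (3 * k) * (r * m)" by simp
  qed
  also have "\<dots> = 2 * (r ^ 3 * (r ^ (3 * k) * (r * m)))"
    by (simp only: mult_2 distrib_left)
  also have "\<dots> = 2 * (r ^ (3 + 3 * k + 1) * m)"
    by (simp only: power_add power_one_right mult.assoc)
  also have "\<dots> \<le> r * (r ^ (3 + 3 * k + 1) * m)"
    using assms(1) by (rule mult_le_mono1)
  finally have e_le: "e \<le> r * (r ^ (3 + 3 * k + 1) * m)" .
  have "deviation_bound r k \<le> 4 * e"
    using m_ge m_e by (simp add: deviation_bound_def e_def)
  also have "\<dots> \<le> r ^ 2 * (r * (r ^ (3 + 3 * k + 1) *
      r ^ (3 * k + (3 * (2 ^ k - 1) + (2 + (3 * k + 3))))))"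
    using e_le m_le by (intro mult_le_mono r2 order_trans[OF e_le] order_refl)
  also have "\<dots> = r ^ (2 + (1 + ((3 + 3 * k + 1) + (3 * k + (3 * (2 ^ k - 1) + (2 + (3 * k + 3)))))))"
    by (simp only: power_add power_one_right)
  also have "\<dots> \<le> (8 * (k - 1) * r) ^ ((8 * (k - 1) * r) ^ k)"
  proof -
    have k2: "k < 2 ^ k" by (rule less_exp)
    have p4: "(4 :: nat) \<le> 2 ^ k"
      using power_increasing[OF assms(2), of "2 :: nat"] by simp
    have base: "16 \<le> 8 * (k - 1) * r" "r \<le> 8 * (k - 1) * r"
    proof -
      have "8 * 1 * 2 \<le> 8 * (k - 1) * r" using assms by (intro mult_le_mono) auto
      then show "16 \<le> 8 * (k - 1) * r" by simp
      have "1 * r \<le> 8 * (k - 1) * r" using assms by (intro mult_le_mono1) auto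
      then show "r \<le> 8 * (k - 1) * r" by simp
    qed
    \<comment> \<open>The constant 64 is \<open>8 ^ 2\<close>, so the exponent is at most
      \<open>8 ^ k * 2 ^ k = 16 ^ k\<close>, and 16 is the least possible value of
      \<open>8 * (k - 1) * r\<close>.\<close>
    have "2 + (1 + ((3 + 3 * k + 1) + (3 * k + (3 * (2 ^ k - 1) + (2 + (3 * k + 3)))))) \<le> 64 * 2 ^ k"
      using k2 p4 by linarith
    also have "\<dots> \<le> 8 ^ k * 2 ^ k"
      using power_increasing[OF assms(2), of "8 :: nat"] by (intro mult_le_mono1) simp
    also have "\<dots> = 16 ^ k"
      by (simp flip: power_mult_distrib)
    also have "\<dots> \<le> (8 * (k - 1) * r) ^ k"
      by (intro power_mono base) auto
    finally have "r ^ (2 + (1 + ((3 + 3 * k + 1) + (3 * k + (3 * (2 ^ k - 1) + (2 + (3 * k + 3)))))))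
        \<le> r ^ ((8 * (k - 1) * r) ^ k)"
      using r1 by (intro power_increasing)
    also have "\<dots> \<le> (8 * (k - 1) * r) ^ ((8 * (k - 1) * r) ^ k)"
      by (intro power_mono base) auto
    finally show ?thesis .
  qed
  finally show ?thesis .
qed

text \<open>The colours are unit vectors, so the l1 deviation of the counts bounds the distance from
  the factor's sum to the target sum. The latter is at most \<open>1 / n\<close> times the sum over
  the complete graph in norm.\<close>

lemma exists_balanced_factor:
  fixes c :: "nat set \<Rightarrow> 'v :: real_normed_vector" and S :: "'v set" and H :: "nat graph"
  assumes n: "0 < n" and r: "2 \<le> r" and S: "finite S" "S \<subseteq> sphere 0 1"
    and H: "simple_graph H" "card (verts H) = r"
    and c: "c \<in> edges (complete_graph (n * r)) \<rightarrow> S"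
    and total_le: "norm (\<Sum>e \<in> edges (complete_graph (n * r)). c e) \<le> \<alpha>"
  shows "\<exists>F. is_factor H n (complete_graph (n * r)) F \<and>
    norm (\<Sum>e \<in> edges F. c e) \<le> deviation_bound r (card S) + \<alpha> / real n"
proof -
  have fin_H: "finite (verts H)" and edges_H: "edges H \<subseteq> nsets (verts H) 2"
    using H by (auto simp: simple_graph_def)
  obtain h where h: "bij_betw h {..<r} (verts H)"
    using finite_same_card_bij[of "{..<r}" "verts H"] fin_H H(2) by auto
  define E where "E = {e \<in> nsets {..<r} 2. h ` e \<in> edges H}"
  have edges_eq: "edges H = (\<lambda>e. h ` e) ` E"
  proof (intro equalityI subsetI)
    fix e assume e: "e \<in> edges H"
    then have "e \<subseteq> verts H" "finite e" "card e = 2"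
      using edges_H by (auto simp: nsets_def)
    define e' where "e' = {a \<in> {..<r}. h a \<in> e}"
    have im: "h ` e' = e"
      using h \<open>e \<subseteq> verts H\<close> by (fastforce simp: e'_def bij_betw_def)
    have "inj_on h e'"
      using h by (auto simp: bij_betw_def e'_def inj_on_def)
    then have "card e' = 2" using card_image im \<open>card e = 2\<close> by metis
    then have "e' \<in> E"
      using im e by (auto simp: E_def nsets_def e'_def)
    then show "e \<in> (\<lambda>e. h ` e) ` E" using im by blast
  qed (auto simp: E_def)
  let ?K = "nsets {..<n * r} 2"
  \<comment> \<open>singletons must not carry a colour, and \<open>0\<close> is not on the sphere\<close>
  define c' where "c' e = (if e \<in> ?K then c e else 0)" for e
  have c_S: "c e \<in> S" if "e \<in> ?K" for e
    using c that by (auto simp: complete_graph_def)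
  interpret factor_colouring n r E c' S
  proof
    show "c' {v} \<notin> S" for v
      using S(2) by (auto simp: c'_def nsets_def)
  qed (use n r S in \<open>auto simp: E_def\<close>)
  obtain P where P: "bij_betw P cells {..<n * r}" and dev: "deviation P \<le> deviation_bound r (card S)"
    by (rule exists_small_deviation)
  have sub: "factor_edges P \<subseteq> ?K"
    using card_copy_edge[OF P] by (auto simp: factor_edges_def)
  have fac: "(\<Sum>e\<in>factor_edges P. c e) = (\<Sum>s\<in>S. real_of_int (count P s) *\<^sub>R s)"
  proof -
    have "(\<Sum>e\<in>factor_edges P. of_bool (c e = s)) = count P s" for s
    proof -
      have "(\<Sum>e\<in>factor_edges P. of_bool (c e = s) :: int) = (\<Sum>e\<in>factor_edges P. of_bool (c' e = s))"
        using sub by (intro sum.cong) (auto simp: c'_def)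
      then show ?thesis
        by (simp add: sum_factor_edges[OF P] count_def copy_count_def)
    qed
    then show ?thesis
      using sum_by_colour[of S "factor_edges P" c] S(1) sub c_S by auto
  qed
  have tot: "(\<Sum>e\<in>?K. c e) = (\<Sum>s\<in>S. real_of_int (total s) *\<^sub>R s)"
  proof -
    have "(\<Sum>e\<in>?K. of_bool (c e = s)) = total s" for s
      unfolding total_def by (intro sum.cong) (auto simp: c'_def)
    then show ?thesis
      using sum_by_colour[of S ?K c] S(1) c_S by auto
  qed
  let ?q = "2 * card E / (real n * real r ^ 2)"
  have target: "(\<Sum>s\<in>S. target s *\<^sub>R s) = ?q *\<^sub>R (\<Sum>e\<in>?K. c e)"
    by (simp add: tot target_def scaleR_sum_right)
  have q: "?q \<le> 1 / n"
  proof -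
    have "2 * card E \<le> r * r"
      using two_card_E by (meson diff_le_self mult_le_mono2 order_trans)
    then have "real (2 * card E) \<le> real (r * r)" by (rule of_nat_mono)
    then show ?thesis
      using n r by (simp add: field_simps power2_eq_square)
  qed
  have "norm (\<Sum>s\<in>S. target s *\<^sub>R s) \<le> 1 / n * \<alpha>"
    unfolding target norm_scaleR
    using total_le q by (intro mult_mono) (auto simp: complete_graph_def)
  moreover have "norm (\<Sum>s\<in>S. (count P s - target s) *\<^sub>R s) \<le> deviation P"
    unfolding deviation_def
    by (rule order_trans[OF norm_sum]) (use S(2) in \<open>auto intro!: sum_mono\<close>)
  moreover have "(\<Sum>e\<in>factor_edges P. c e) =
      (\<Sum>s\<in>S. (count P s - target s) *\<^sub>R s) + (\<Sum>s\<in>S. target s *\<^sub>R s)"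
    by (simp add: fac scaleR_diff_left sum_subtractf)
  ultimately have "norm (\<Sum>e\<in>factor_edges P. c e) \<le> deviation_bound r (card S) + \<alpha> / n"
    using dev norm_triangle_ineq[of "\<Sum>s\<in>S. (count P s - target s) *\<^sub>R s" "\<Sum>s\<in>S. target s *\<^sub>R s"]
    by simp
  then show ?thesis
    using is_factor_factor_edges[OF P h edges_eq] by auto
qed

theorem theorem1p2:
  fixes k r :: nat and S :: "(real ^ 'd) set"
  assumes "k \<ge> 2" and "r \<ge> 2" and "CARD('d) \<ge> 2"
    and "S \<subseteq> sphere 0 1" and "card S = k"
  shows "\<exists>C :: real.
    (\<forall>(H :: nat graph) (n :: nat) (\<alpha> :: real) (c :: nat set \<Rightarrow> real ^ 'd).
       simple_graph H \<and> card (verts H) = r \<and> n > 0 \<and> \<alpha> > 0 \<and>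
       c \<in> edges (complete_graph (n * r)) \<rightarrow> S \<and>
       norm (\<Sum>e \<in> edges (complete_graph (n * r)). c e) \<le> \<alpha> \<longrightarrow>
       (\<exists>F. is_factor H n (complete_graph (n * r)) F \<and>
            norm (\<Sum>e \<in> edges F. c e) \<le> C + 2 * \<alpha> / real n)) \<and>
    (k = CARD('d) + 1 \<and> regular_simplex_vertices S \<longrightarrow>
       C = real (8 * CARD('d) * r) ^ ((8 * CARD('d) * r) ^ (CARD('d) + 1)))"
proof (rule exI[of _ "real (8 * (k - 1) * r) ^ ((8 * (k - 1) * r) ^ k)"], intro conjI allI impI)
  \<comment> \<open>The constant depends on \<open>S\<close> only through \<open>k\<close>. In the
    simplex case \<open>k - 1\<close> is the dimension, and it becomes the stated value.\<close>
  let ?C = "real (8 * (k - 1) * r) ^ ((8 * (k - 1) * r) ^ k)"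
  fix H :: "nat graph" and n :: nat and \<alpha> :: real and c :: "nat set \<Rightarrow> real ^ 'd"
  assume A: "simple_graph H \<and> card (verts H) = r \<and> n > 0 \<and> \<alpha> > 0 \<and>
       c \<in> edges (complete_graph (n * r)) \<rightarrow> S \<and>
       norm (\<Sum>e \<in> edges (complete_graph (n * r)). c e) \<le> \<alpha>"
  have "finite S" using assms by (intro card_ge_0_finite) simp
  then obtain F where F: "is_factor H n (complete_graph (n * r)) F"
    and le: "norm (\<Sum>e \<in> edges F. c e) \<le> deviation_bound r k + \<alpha> / real n"
    using exists_balanced_factor[of n r S H c \<alpha>] A assms by blast
  have "real (deviation_bound r k) \<le> real ((8 * (k - 1) * r) ^ ((8 * (k - 1) * r) ^ k))"
    by (intro of_nat_mono deviation_bound_le assms)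
  also have "\<dots> = ?C" by (rule of_nat_power)
  finally have "real (deviation_bound r k) \<le> ?C" .
  moreover have "\<alpha> / n \<le> 2 * \<alpha> / n"
    using A by (intro divide_right_mono) auto
  ultimately show "\<exists>F. is_factor H n (complete_graph (n * r)) F \<and>
      norm (\<Sum>e \<in> edges F. c e) \<le> ?C + 2 * \<alpha> / real n"
    using F le by (intro exI[of _ F] conjI) linarith+
qed simp

end
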